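(* Let $q\ge 6$ be a prime power and let $\bar{\mathcal C}$ be an $\mathbb F_q$-conic in an $\mathbb F_q$-subplane $\bar\pi$ of $\mathrm{PG}(2,q^3)$ that is secant to $\ell_\infty$. In the exact-at-infinity Bruck-Bose representation in $\mathrm{PG}(6,q)$, the curve $\mathcal V([\mathcal C])$ decomposes into a non-degenerate conic $\mathcal N_2$ (which lies in a plane of $\mathrm{PG}(6,q)$, not contained in $\Sigma_\infty$, that meets $q+1$ spread planes of $\mathcal S$), together with two planes in $\Sigma_\infty$ (possibly repeated, possibly in the extension $\Sigma_\infty^{\star\star}\setminus\Sigma_\infty$).
   Context: **$\mathbb F_q$-conics.** An $\mathbb F_q$-subplane of $\mathrm{PG}(2,q^3)$ is a subplane of order $q$; it is secant, tangent or exterior to a line if it meets it in $q+1$, $1$ or $0$ points. An $\mathbb F_q$-conic is a non-degenerate conic of an $\mathbb F_q$-subplane. For an $\mathbb F_q$-conic $\bar{\mathcal C}$, $\bar{\mathcal C}^{+}$ is the unique non-degenerate conic of $\mathrm{PG}(2,q^3)$ containing it, and $\bar{\mathcal C}^{++}$ the unique non-degenerate conic of $\mathrm{PG}(2,q^6)$ containing $\bar{\mathcal C}^+$. A line $\ell_\infty$ of $\mathrm{PG}(2,q^3)$ is fixed as line at infinity. **Conjugacy.** For an $\mathbb F_q$-subplane $\bar\pi$, $\bar{\mathsf c}_\pi$ is the collineation $\bar X\mapsto B\bar X^q$ ($B\in\mathrm{GL}(3,q^3)$) of $\mathrm{PG}(2,q^3)$ that has order 3 and fixes $\bar\pi$ pointwise;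 the same formula defines it on $\mathrm{PG}(2,q^6)$, where it has order 6. **Bose representation.** Embed $\mathrm{PG}(8,q)\subset\mathrm{PG}(8,q^3)\subset\mathrm{PG}(8,q^6)$; $X^q$ is obtained by raising coordinates to the $q$-th power. For a subspace or variety $\mathcal K$ given over $\mathbb F_q$, $\mathcal K^\star$ and $\mathcal K^{\star\star}$ denote the pointsets over $\mathbb F_{q^3}$ and $\mathbb F_{q^6}$ of the same equations; for a subspace $\Sigma$ of $\mathrm{PG}(8,q^3)$, $\Sigma^{\star\star}$ is its extension to $\mathrm{PG}(8,q^6)$. Let $\Gamma$ be a plane of $\mathrm{PG}(8,q^3)$ disjoint from $\mathrm{PG}(8,q)$ such that $\Gamma,\Gamma^q,\Gamma^{q^2}$ span $\mathrm{PG}(8,q^3)$. The planes $[\![X]\!]=\langle X,X^q,X^{q^2}\rangle\cap\mathrm{PG}(8,q)$, $X\in\Gamma$, form a regular 2-spread of $\mathrm{PG}(8,q)$. Identify $\mathrm{PG}(2,q^3)$ with $\Gamma$ (and $\mathrm{PG}(2,q^6)$ with $\Gamma^{\star\star}$) by a linear isomorphism, $\bar X\leftrightarrow X$; dropping the bar denotes the corresponding object in $\Gamma$ or $\Gamma^{\star\star}$ (so $\mathcal C,\mathcal C^+,\mathcal C^{++},\mathsf c_\pi$). **Scroll-planes.** For $X\in\Gamma^{\star\star}$, the $\pi$-scroll-plane is $(\!(X)\!)_\pi=\langle X,(X^{\mathsf c_\pi^5})^q,(X^{\mathsf c_\pi^4})^{q^2}\rangle$; for $X\in\Gamma$ this is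 $\langle X,(X^{\mathsf c_\pi^2})^q,(X^{\mathsf c_\pi})^{q^2}\rangle$. **Exact-at-infinity Bruck-Bose representation.** Let $g\subset\Gamma$ be the line corresponding to $\ell_\infty$, $\Sigma_\infty=\langle g,g^q,g^{q^2}\rangle\cap\mathrm{PG}(8,q)$ (a 5-space), and $\Sigma_{6,q}\cong\mathrm{PG}(6,q)$ a 6-space of $\mathrm{PG}(8,q)$ containing $\Sigma_\infty$ as its hyperplane at infinity. The planes $[\![X]\!]$, $X\in g$, form a regular 2-spread $\mathcal S$ of $\Sigma_\infty$, with transversal lines $g,g^q,g^{q^2}$; its elements are the spread planes. For a point $\bar X$ let $[X]=[\![X]\!]\cap\Sigma_{6,q}$: a point of $\Sigma_{6,q}\setminus\Sigma_\infty$ if $\bar X\notin\ell_\infty$, the spread plane $[\![X]\!]$ if $\bar X\in\ell_\infty$. $[\mathcal C]$ is the set of points lying in the $[X]$, $\bar X\in\bar{\mathcal C}$. **Varieties.** It is known that the pointset of $\{[\![X]\!]:X\in\mathcal C\}$ is an intersection $\mathcal V([\![\mathcal C]\!])$ of nine quadrics of $\mathrm{PG}(8,q)$, that $\mathcal V([\![\mathcal C]\!])^\star$ is the set of points on the planes $(\!(X)\!)_\pi$, $X\in\mathcal C^+$, and $\mathcal V([\![\mathcal C]\!])^{\star\star}$ is the set of points on the planes $(\!(X)\!)_\pi$, $X\in\mathcal C^{++}$. Put $\mathcal V([\mathcal C])=\mathcal V([\![\mathcal C]\!])\cap\Sigma_{6,q}$ (its pointset is $[\mathcal C]$), with extensions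 $\mathcal V([\mathcal C])^\star=\mathcal V([\![\mathcal C]\!])^\star\cap\Sigma_{6,q}^\star$ and $\mathcal V([\mathcal C])^{\star\star}=\mathcal V([\![\mathcal C]\!])^{\star\star}\cap\Sigma_{6,q}^{\star\star}$. *)

theory Defs
  imports "HOL-Analysis.Analysis" "HOL-Number_Theory.Prime_Powers"
begin

text \<open>
  The whole tower of fields lives in one type \<open>'a\<close> with \<open>q^6\<close> elements: the subfield of order
  \<open>q^k\<close> (for \<open>k\<close> in \<open>{1, 3, 6}\<close>) is the set of roots of \<open>x^(q^k) = x\<close>.
  Points are one-dimensional \<open>'a\<close>-subspaces of \<open>'a^'n\<close>, and \<open>PG(n-1, q^k)\<close> is the set of those points
  that have a representative with coordinates in the field of order \<open>q^k\<close>, so that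
  \<open>PG(n-1, q)\<close>, \<open>PG(n-1, q^3)\<close> and \<open>PG(n-1, q^6)\<close> are literally contained in one another.
\<close>

definition subfld :: "nat \<Rightarrow> nat \<Rightarrow> 'a::field set" where
  "subfld q k = {x. x ^ (q ^ k) = x}"

definition vecs_over :: "nat \<Rightarrow> nat \<Rightarrow> ('a::field ^ 'n) set" where
  "vecs_over q k = {v. \<forall>i. v $ i \<in> subfld q k}"

definition mat_over :: "nat \<Rightarrow> nat \<Rightarrow> 'a::field ^ 'm ^ 'n \<Rightarrow> bool" where
  "mat_over q k A \<longleftrightarrow> (\<forall>i j. A $ i $ j \<in> subfld q k)"

definition PG :: "nat \<Rightarrow> nat \<Rightarrow> ('a::field ^ 'n) set set" where
  "PG q k = {vec.span {v} | v. v \<in> vecs_over q k \<and> v \<noteq> 0}"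

text \<open>
  A projective subspace of \<open>PG(n-1, q^k)\<close> of projective dimension \<open>d\<close> is represented by the
  \<open>'a\<close>-subspace \<open>W\<close> it spans. Its points over the field of order \<open>q^m\<close> are \<open>points q m W\<close>; thus
  \<open>points q 1 W\<close>, \<open>points q 3 W\<close>, \<open>points q 6 W\<close> are the subspace of \<open>PG(n-1, q)\<close> itself and its
  extensions (one star, two stars).
\<close>

definition proj_subspace :: "nat \<Rightarrow> nat \<Rightarrow> nat \<Rightarrow> ('a::field ^ 'n) set \<Rightarrow> bool" where
  "proj_subspace q k d W \<longleftrightarrow>
     (\<exists>S. S \<subseteq> vecs_over q k \<and> W = vec.span S) \<and> vec.dim W = d + 1"

definition points :: "nat \<Rightarrow> nat \<Rightarrow> ('a::field ^ 'n) set \<Rightarrow> ('a ^ 'n) set set" where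
  "points q k W = {P \<in> PG q k. P \<subseteq> W}"

definition frob :: "nat \<Rightarrow> 'a::field ^ 'n \<Rightarrow> 'a ^ 'n" where
  "frob m v = (\<chi> i. (v $ i) ^ m)"

text \<open>
  Quadratic forms are given by (not necessarily symmetric) coefficient matrices, which covers
  characteristic two. A form is non-degenerate on \<open>W\<close> if the quadric it defines in \<open>W\<close> has no
  singular point. Over the finite fields considered here the singular points of a conic are
  already visible over the field of definition, so it does not matter that \<open>W\<close> consists of
  vectors over the largest field.
\<close>

definition quad :: "'a::field ^ 'n ^ 'n \<Rightarrow> 'a ^ 'n \<Rightarrow> 'a" where
  "quad A x = (\<Sum>i\<in>UNIV. \<Sum>j\<in>UNIV. A $ i $ j * x $ i * x $ j)"

definition polar :: "'a::field ^ 'n ^ 'n \<Rightarrow> 'a ^ 'n \<Rightarrow> 'a ^ 'n \<Rightarrow> 'a" where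
  "polar A x y = quad A (x + y) - quad A x - quad A y"

definition nondegenerate_on :: "('a::field ^ 'n) set \<Rightarrow> 'a ^ 'n ^ 'n \<Rightarrow> bool" where
  "nondegenerate_on W A \<longleftrightarrow>
     (\<forall>x\<in>W. x \<noteq> 0 \<and> quad A x = 0 \<longrightarrow> (\<exists>y\<in>W. polar A x y \<noteq> 0))"

definition quadric_points ::
    "nat \<Rightarrow> nat \<Rightarrow> 'a::field ^ 'n ^ 'n \<Rightarrow> ('a ^ 'n) set set" where
  "quadric_points q k A = {P \<in> PG q k. \<forall>x\<in>P. quad A x = 0}"

definition nondeg_conic :: "nat \<Rightarrow> nat \<Rightarrow> ('a::field ^ 3) set set \<Rightarrow> bool" where
  "nondeg_conic q k D \<longleftrightarrow>
     (\<exists>A. mat_over q k A \<and> nondegenerate_on UNIV A \<and> D = quadric_points q k A)"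

text \<open>
  A subplane of order \<open>q\<close> of \<open>PG(2, q^3)\<close>: a set of points which, with the lines meeting it in at
  least two points, is a projective plane with \<open>q + 1\<close> points on each line.
\<close>

definition Fq_subplane :: "nat \<Rightarrow> ('a::field ^ 3) set set \<Rightarrow> bool" where
  "Fq_subplane q B \<longleftrightarrow>
     B \<subseteq> PG q 3 \<and>
     (\<exists>F \<subseteq> B. card F = 4 \<and>
        (\<forall>l. proj_subspace q 3 1 l \<longrightarrow> card (points q 3 l \<inter> F) \<le> 2)) \<and>
     (\<forall>l m. proj_subspace q 3 1 l \<and> proj_subspace q 3 1 m \<and> l \<noteq> m \<and>
        card (points q 3 l \<inter> B) \<ge> 2 \<and> card (points q 3 m \<inter> B) \<ge> 2 \<longrightarrow>
        points q 3 l \<inter> points q 3 m \<inter> B \<noteq> {}) \<and>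
     (\<forall>l. proj_subspace q 3 1 l \<and> card (points q 3 l \<inter> B) \<ge> 2 \<longrightarrow>
        card (points q 3 l \<inter> B) = q + 1)"

definition secant :: "nat \<Rightarrow> ('a::field ^ 3) set set \<Rightarrow> ('a ^ 3) set \<Rightarrow> bool" where
  "secant q B l \<longleftrightarrow> card (points q 3 l \<inter> B) = q + 1"

text \<open>
  Non-degenerate conics of a subplane \<open>B\<close> are transported from \<open>PG(2, q)\<close> along a homography of
  \<open>PG(2, q^3)\<close> mapping \<open>PG(2, q)\<close> onto \<open>B\<close>.
\<close>

definition Fq_conic_in ::
    "nat \<Rightarrow> ('a::field ^ 3) set set \<Rightarrow> ('a ^ 3) set set \<Rightarrow> bool" where
  "Fq_conic_in q B C \<longleftrightarrow>
     (\<exists>A N. mat_over q 3 A \<and> invertible A \<and> B = (\<lambda>P. (*v) A ` P) ` PG q 1 \<and>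
        nondeg_conic q 1 N \<and> C = (\<lambda>P. (*v) A ` P) ` N)"

definition conic_ext :: "nat \<Rightarrow> nat \<Rightarrow> ('a::field ^ 3) set set \<Rightarrow> ('a ^ 3) set set" where
  "conic_ext q k C = (THE D. nondeg_conic q k D \<and> C \<subseteq> D)"

abbreviation conic_plus :: "nat \<Rightarrow> ('a::field ^ 3) set set \<Rightarrow> ('a ^ 3) set set" where
  "conic_plus q C \<equiv> conic_ext q 3 C"

abbreviation conic_plusplus :: "nat \<Rightarrow> ('a::field ^ 3) set set \<Rightarrow> ('a ^ 3) set set" where
  "conic_plusplus q C \<equiv> conic_ext q 6 (conic_plus q C)"

definition conj_map :: "nat \<Rightarrow> 'a::field ^ 3 ^ 3 \<Rightarrow> ('a ^ 3) set \<Rightarrow> ('a ^ 3) set" where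
  "conj_map q B P = (\<lambda>v. B *v frob q v) ` P"

text \<open>
  \<open>B\<close> is a matrix of the collineation \<open>X \<mapsto> B X^q\<close> of order 3 of \<open>PG(2, q^3)\<close> that
  fixes the subplane \<open>\<pi>\<close> pointwise.
\<close>

definition conjugacy_matrix ::
    "nat \<Rightarrow> ('a::field ^ 3) set set \<Rightarrow> 'a ^ 3 ^ 3 \<Rightarrow> bool" where
  "conjugacy_matrix q \<pi> B \<longleftrightarrow>
     mat_over q 3 B \<and> invertible B \<and>
     (\<forall>P\<in>\<pi>. conj_map q B P = P) \<and>
     (\<forall>P\<in>PG q 3. (conj_map q B ^^ 3) P = P) \<and>
     (\<exists>P\<in>PG q 3. conj_map q B P \<noteq> P)"

text \<open>
  The matrix \<open>M\<close>, with entries in the field of order \<open>q^3\<close>, is the linear isomorphism that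
  identifies \<open>PG(2, q^3)\<close> with \<open>\<Gamma>\<close>, and \<open>PG(2, q^6)\<close> with the extension of \<open>\<Gamma>\<close>.
\<close>

definition bose_setting ::
    "nat \<Rightarrow> ('a::field ^ 9) set \<Rightarrow> 'a ^ 3 ^ 9 \<Rightarrow> bool" where
  "bose_setting q \<Gamma> M \<longleftrightarrow>
     proj_subspace q 3 2 \<Gamma> \<and> points q 1 \<Gamma> = {} \<and>
     vec.span (\<Gamma> \<union> frob q ` \<Gamma> \<union> frob (q\<^sup>2) ` \<Gamma>) = UNIV \<and>
     mat_over q 3 M \<and> bij_betw ((*v) M) UNIV \<Gamma>"

text \<open>
  For \<open>X\<close> a point or a line of \<open>PG(2, q^3)\<close>: the span of its copy in \<open>\<Gamma>\<close> and the two conjugates.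
\<close>

definition bose_span :: "nat \<Rightarrow> 'a::field ^ 3 ^ 9 \<Rightarrow> ('a ^ 3) set \<Rightarrow> ('a ^ 9) set" where
  "bose_span q M X =
     vec.span ((*v) M ` X \<union> frob q ` ((*v) M ` X) \<union> frob (q\<^sup>2) ` ((*v) M ` X))"

definition bose_plane :: "nat \<Rightarrow> 'a::field ^ 3 ^ 9 \<Rightarrow> ('a ^ 3) set \<Rightarrow> ('a ^ 9) set set" where
  "bose_plane q M X = points q 1 (bose_span q M X)"

definition spread :: "nat \<Rightarrow> 'a::field ^ 3 ^ 9 \<Rightarrow> ('a ^ 3) set \<Rightarrow> ('a ^ 9) set set set" where
  "spread q M l = bose_plane q M ` points q 3 l"

definition scroll_plane ::
    "nat \<Rightarrow> 'a::field ^ 3 ^ 9 \<Rightarrow> 'a ^ 3 ^ 3 \<Rightarrow> ('a ^ 3) set \<Rightarrow> ('a ^ 9) set" where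
  "scroll_plane q M B X =
     vec.span ((*v) M ` X \<union>
       frob q ` ((*v) M ` ((conj_map q B ^^ 5) X)) \<union>
       frob (q\<^sup>2) ` ((*v) M ` ((conj_map q B ^^ 4) X)))"

definition variety ::
    "nat \<Rightarrow> nat \<Rightarrow> (nat \<Rightarrow> 'a::field ^ 9 ^ 9) \<Rightarrow> ('a ^ 9) set set" where
  "variety q k Q = {P \<in> PG q k. \<forall>i<9. P \<in> quadric_points q k (Q i)}"

text \<open>
  \<open>Q\<close> lists nine quadrics of \<open>PG(8, q)\<close> whose intersection has, over the fields of order \<open>q\<close>,
  \<open>q^3\<close> and \<open>q^6\<close>, the pointsets attached to the Bose representation of the conic \<open>C\<close>.
  The pointset over the field of order \<open>q\<close> alone would not determine the extensions.
\<close>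

definition bose_conic_variety ::
    "nat \<Rightarrow> 'a::field ^ 3 ^ 9 \<Rightarrow> 'a ^ 3 ^ 3 \<Rightarrow> ('a ^ 3) set set \<Rightarrow> (nat \<Rightarrow> 'a ^ 9 ^ 9) \<Rightarrow> bool" where
  "bose_conic_variety q M B C Q \<longleftrightarrow>
     (\<forall>i<9. mat_over q 1 (Q i) \<and> (\<exists>x. quad (Q i) x \<noteq> 0)) \<and>
     variety q 1 Q = (\<Union>X\<in>C. bose_plane q M X) \<and>
     variety q 3 Q = (\<Union>X\<in>conic_plus q C. points q 3 (scroll_plane q M B X)) \<and>
     variety q 6 Q = (\<Union>X\<in>conic_plusplus q C. points q 6 (scroll_plane q M B X))"

end

theory Submission
  imports Defs
begin

text \<open>
  Choose a homography \<open>A\<close> that maps \<open>PG(2, q)\<close> onto the subplane and the conic \<open>x z = y\<^sup>2\<close> onto the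
  given one. With \<open>H = M A\<close>, every vector of the 9-space is uniquely \<open>H a + H\<^sup>q b + H\<^sup>q\<^sup>q c\<close>, and in
  the coordinates \<open>(a, b, c)\<close> the scroll-plane of \<open>A x\<close> consists of the vectors \<open>(s x, t x, u x)\<close>: the
  variety is a piece of a Segre variety. If \<open>l x = 0\<close> is the line at infinity, with \<open>l\<close> over the
  field of order \<open>q\<close>, then the 6-space is given by \<open>(l a, l b, l c) \<in> \<langle>(\<theta>, \<theta>\<^sup>q, \<theta>\<^sup>q\<^sup>q)\<rangle>\<close> for some \<open>\<theta>\<close> in the
  field of order \<open>q^3\<close>. A point \<open>(s x, t x, u x)\<close> of the variety in the 6-space has either
  \<open>l x = 0\<close>, in which case the whole scroll-plane is at infinity and \<open>x\<close> is one of the two points of the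
  conic on the line, or \<open>(s, t, u)\<close> proportional to \<open>(\<theta>, \<theta>\<^sup>q, \<theta>\<^sup>q\<^sup>q)\<close>, which gives a conic in the plane of
  the vectors \<open>(\<theta> x, \<theta>\<^sup>q x, \<theta>\<^sup>q\<^sup>q x)\<close>.
\<close>

section \<open>Subfields of a field with $q^6$ elements\<close>

text \<open>In the coordinates of the frame the conjugacy of the subplane becomes the plain
  Frobenius map. In each twisted generator of a scroll-plane the exponents of conjugacy and
  Frobenius add up to six, and the sixth power of Frobenius is the identity on the large field; this
  is why the twists disappear. The decomposition is an equality of pointsets over three fields with
  one quadric and one pair of planes. The delicate case is that of two points at infinity that are
  conjugate over the field of order q^2. The conic over orders q and q^3 does not contain them, so
  their scroll-planes must have no points over these fields: the cube of Frobenius still swaps the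
  two points, and only order q^6 sees them. The conic must be normalised over order q itself, since
  the frame has to keep mapping PG(2, q) onto the subplane; this needs a rational point in every
  characteristic, including two. The size of q matters for the uniqueness of the extended conics: a
  polynomial of degree 4 has to vanish once it has q zeros.\<close>

lemma card_image_fibre_le:
  assumes "finite A" and "\<And>z. z \<in> A \<Longrightarrow> card {x \<in> A. f x = f z} \<le> m"
  shows "card A \<le> m * card (f ` A)"
proof -
  have "card A = card (\<Union>y\<in>f ` A. {x \<in> A. f x = y})"
    by (rule arg_cong[of _ _ card]) auto
  also have "\<dots> \<le> (\<Sum>y\<in>f ` A. card {x \<in> A. f x = y})"
    using assms(1) by (intro card_UN_le) auto
  also have "\<dots> \<le> (\<Sum>y\<in>f ` A. m)"
    using assms(2) by (intro sum_mono) auto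
  finally show ?thesis by (simp add: mult.commute)
qed

lemma card_le_two: "S \<subseteq> {x \<in> A. x = a \<or> x = b} \<Longrightarrow> card S \<le> 2"
proof -
  assume "S \<subseteq> {x \<in> A. x = a \<or> x = b}"
  hence "card S \<le> card {a, b}"
    by (intro card_mono) auto
  also have "\<dots> \<le> 2" by (simp add: card_insert_le_m1)
  finally show ?thesis .
qed

locale tower =
  fixes q :: nat and ty :: "'a::{field,finite} itself"
  assumes primepow_q: "primepow q" and card_UNIV: "CARD('a) = q ^ 6"
begin

text \<open>The exponents of the powers of Frobenius; one predicate serves \<open>q\<close>, q^2 and
  every \<open>q ^ k\<close>.\<close>

definition qpow :: "nat \<Rightarrow> bool" where "qpow n \<longleftrightarrow> (\<exists>k. n = q ^ k)"

lemma qpow_simps [simp]: "qpow (q ^ k)" "qpow q" "qpow (Suc 0)"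
  unfolding qpow_def
  by blast (metis power_one_right, metis One_nat_def power_0)

lemma q_gt_1: "q > 1"
  using primepow_q by (simp add: primepow_gt_Suc_0)

lemma prime_char: "prime CHAR('a)"
  by (simp add: finite_imp_CHAR_pos prime_CHAR_semidom)

lemma q_char: "\<exists>n. q = CHAR('a) ^ n"
proof -
  obtain p n where p: "prime p" "n > 0" "q = p ^ n"
    using primepow_q by (auto simp: primepow_def)
  have "CHAR('a) dvd q ^ 6"
  proof -
    \<comment> \<open>Translation by 1 permutes the field, so the sum of all elements does not
      change and q^6 times 1 is zero.\<close>
    have "(\<Sum>x\<in>UNIV. x :: 'a) = (\<Sum>x\<in>UNIV. x + 1)"
      by (rule sum.reindex_bij_witness[of _ "\<lambda>x. x + 1" "\<lambda>x. x - 1"]) auto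
    hence "of_nat (CARD('a)) = (0 :: 'a)"
      by (simp add: sum.distrib)
    thus ?thesis by (simp only: card_UNIV of_nat_eq_0_iff_char_dvd)
  qed
  hence "CHAR('a) dvd p"
    using prime_char p by (auto dest: prime_dvd_power)
  hence "CHAR('a) = p"
    using prime_char p(1) by (simp add: primes_dvd_imp_eq)
  with p show ?thesis by blast
qed

lemma add_pow: "qpow n \<Longrightarrow> (x + y :: 'a) ^ n = x ^ n + y ^ n"
proof -
  assume "qpow n"
  then obtain k where k: "n = q ^ k" by (auto simp: qpow_def)
  obtain l where l: "q = CHAR('a) ^ l" using q_char by blast
  have "n = CHAR('a) ^ (l * k)" by (simp add: k l power_mult)
  thus ?thesis by (rule freshmans_dream'[OF prime_char])
qed

lemma qpow_pos: "qpow n \<Longrightarrow> n > 0"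
  using q_gt_1 by (auto simp: qpow_def)

lemma minus_pow: "qpow n \<Longrightarrow> (- x :: 'a) ^ n = - (x ^ n)"
  using add_pow[of n x "- x"] qpow_pos[of n] by (simp add: eq_neg_iff_add_eq_0 add.commute[of "(- x) ^ n"] power_0_left)

lemma diff_pow: "qpow n \<Longrightarrow> (x - y :: 'a) ^ n = x ^ n - y ^ n"
  using add_pow[of n x "- y"] minus_pow[of n y] by simp

lemma inj_pow: "qpow n \<Longrightarrow> (x :: 'a) ^ n = y ^ n \<longleftrightarrow> x = y"
  using diff_pow[of n x y] qpow_pos[of n] by auto

lemma sum_pow: "qpow n \<Longrightarrow> (sum f A :: 'a) ^ n = (\<Sum>i\<in>A. f i ^ n)"
  by (induction A rule: infinite_finite_induct) (auto simp: add_pow dest: qpow_pos)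

lemma pow6: "(x :: 'a) ^ (q ^ 6) = x"
proof -
  have "x ^ CARD('a) = x"
  proof (cases "x = 0")
    case False
    \<comment> \<open>Multiplication by \<open>x\<close> permutes the nonzero elements, so their
      product occurs on both sides and cancels.\<close>
    have "x * (\<Prod>y\<in>UNIV-{0}. x * y) = x * x ^ (CARD('a) - 1) * \<Prod>(UNIV-{0})"
      by (simp add: prod.distrib mult_ac)
    also have "x * x ^ (CARD('a) - 1) = x ^ Suc (CARD('a) - 1)"
      by (subst power_Suc) auto
    also have "Suc (CARD('a) - 1) = CARD('a)"
      using finite_UNIV_card_ge_0[where ?'a = 'a] by simp
    also have "(\<Prod>y\<in>UNIV-{0}. x * y) = (\<Prod>y\<in>UNIV-{0}. y)"
      by (rule prod.reindex_bij_witness[of _ "\<lambda>y. y / x" "\<lambda>y. x * y"]) (use False in auto)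
    finally show ?thesis by simp
  qed (use finite_UNIV_card_ge_0[where ?'a = 'a] in auto)
  thus ?thesis by (simp add: card_UNIV)
qed

lemma subfld_6: "subfld q 6 = (UNIV :: 'a set)"
  by (simp add: subfld_def pow6)

lemma subfld_1_iff: "(x :: 'a) \<in> subfld q 1 \<longleftrightarrow> x ^ q = x"
  by (simp add: subfld_def)

lemma pow_q2: "(x :: 'a) ^ (q\<^sup>2) = (x ^ q) ^ q"
  by (simp add: power2_eq_square power_mult)

lemma pow_q3: "(x :: 'a) ^ (q ^ 3) = ((x ^ q) ^ q) ^ q"
  by (simp add: power3_eq_cube power_mult)

lemma subfld_1_imp: "(x :: 'a) \<in> subfld q 1 \<Longrightarrow> x \<in> subfld q k"
proof (induction k)
  case (Suc k)
  thus ?case by (auto simp: subfld_def power_mult)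
qed (simp add: subfld_def)

lemma subfld_binary:
  assumes "(x :: 'a) \<in> subfld q k" and "y \<in> subfld q k"
  shows "x + y \<in> subfld q k" "x - y \<in> subfld q k" "x * y \<in> subfld q k" "x / y \<in> subfld q k"
  using assms unfolding subfld_def
  by (simp_all add: add_pow diff_pow power_mult_distrib power_divide)

lemma subfld_unary:
  assumes "(x :: 'a) \<in> subfld q k"
  shows "- x \<in> subfld q k" "inverse x \<in> subfld q k" "x ^ n \<in> subfld q k"
  using assms unfolding subfld_def
  by (simp_all add: minus_pow power_inverse power_mult[symmetric] mult.commute[of n])
    (simp add: power_mult)

lemmas subfld_closed = subfld_binary subfld_unary

lemma subfld_01 [simp]: "(0 :: 'a) \<in> subfld q k" "(1 :: 'a) \<in> subfld q k"
  using q_gt_1 by (auto simp: subfld_def)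

text \<open>With m = q^k - 1 and q^6 - 1 = m d, all m d nonzero elements are roots of X^(m d) - 1 =
  (X^m - 1) p. The cofactor p has at most m (d - 1) roots, so X^m - 1 has at least m of them, and by
  its degree no more.\<close>

lemma card_subfld:
  assumes k: "k dvd 6" 
  shows "card (subfld q k :: 'a set) = q ^ k"
proof -
  define m where "m = q ^ k - 1"
  have k0: "k > 0" using k by (auto intro: Nat.gr0I)
  have qk: "q ^ k > 1" by (rule one_less_power[OF q_gt_1 k0])
  hence m: "m > 0" "q ^ k = Suc m" by (auto simp: m_def)
  obtain j where j: "6 = k * j" using k by (auto simp: dvd_def)
  have j0: "j > 0" using j by (auto intro: Nat.gr0I)
  have "m dvd q ^ 6 - 1"
  proof -
    have "int (q ^ k) - 1 dvd int (q ^ k) ^ j - 1"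
      by (metis power_diff_1_eq dvd_triv_left)
    also have "int (q ^ k) ^ j - 1 = int (q ^ 6 - 1)"
      using q_gt_1 by (subst of_nat_diff) (auto simp: j power_mult)
    also have "int (q ^ k) - 1 = int m" using m by simp
    finally show ?thesis by simp
  qed
  then obtain d where d: "q ^ 6 - 1 = m * d" by (auto simp: dvd_def)
  have q6: "q ^ 6 > 1" by (rule one_less_power[OF q_gt_1]) simp
  with d have "q ^ 6 = Suc (m * d)" by linarith
  have d0: "d > 0" using d q6 by (auto intro: Nat.gr0I)
  define A where "A = {x :: 'a. x ^ m = 1}"
  define p where "p = (\<Sum>i<d. monom (1 :: 'a) (m * i))"
  define B where "B = {x :: 'a. poly p x = 0}"
  have AB: "UNIV - {0} \<subseteq> A \<union> B"
  proof
    fix x :: 'a assume "x \<in> UNIV - {0}"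
    hence "x ^ (m * d) = 1"
      using pow6[of x] \<open>q ^ 6 = Suc (m * d)\<close> by auto
    hence "(x ^ m - 1) * (\<Sum>i<d. (x ^ m) ^ i) = 0"
      by (simp add: power_diff_1_eq[symmetric] power_mult)
    thus "x \<in> A \<union> B"
      by (auto simp: A_def B_def p_def poly_sum poly_monom power_mult)
  qed
  have cp: "coeff p 0 = 1"
  proof -
    have "coeff p 0 = (\<Sum>i<d. if i = 0 then 1 else 0)"
      unfolding p_def coeff_sum using m by (intro sum.cong) auto
    thus ?thesis using d0 by simp
  qed
  hence "p \<noteq> 0" by auto
  have "degree p \<le> m * (d - 1)"
    unfolding p_def using d0
    by (intro degree_sum_le) (auto intro!: order.trans[OF degree_monom_le])
  hence "card B \<le> m * (d - 1)"
    using card_poly_roots_bound[OF \<open>p \<noteq> 0\<close>] unfolding B_def by linarith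
  moreover have "m * d \<le> card A + card B"
  proof -
    have "m * d = card (UNIV - {0 :: 'a})"
      by (simp add: card_UNIV flip: d)
    also have "\<dots> \<le> card (A \<union> B)" by (rule card_mono[OF _ AB]) auto
    also have "\<dots> \<le> card A + card B" by (rule card_Un_le)
    finally show ?thesis .
  qed
  moreover have "m * d = m * (d - 1) + m" using d0 by (cases d) auto
  ultimately have cA: "m \<le> card A" by linarith
  have sA: "subfld q k = insert 0 A"
    using m by (auto simp: subfld_def A_def)
  have "0 \<notin> A" using m by (simp add: A_def power_0_left)
  hence "card (subfld q k :: 'a set) = Suc (card A)"
    by (simp add: sA)
  moreover have "card A \<le> m"
  proof -
    have 1: "monom (1 :: 'a) m - 1 \<noteq> 0"
    proof
      assume "monom (1 :: 'a) m - 1 = 0"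
      hence "poly (monom (1 :: 'a) m - 1) 0 = 0" by simp
      thus False using m by (simp add: poly_monom power_0_left)
    qed
    have "card {x. poly (monom (1 :: 'a) m - 1) x = 0} \<le> degree (monom (1 :: 'a) m - 1)"
      using card_poly_roots_bound[OF 1] by simp
    also have "\<dots> \<le> m" by (rule degree_diff_le) (auto simp: degree_monom_le)
    finally show ?thesis by (simp add: A_def poly_monom)
  qed
  ultimately show ?thesis using cA m by simp
qed

text \<open>Frobenius has order dividing 3 on the field of order q^3, so an element that it moves
  has three distinct conjugates.\<close>

lemma subfld_3_generator:
  obtains t :: 'a where "t \<in> subfld q 3" "t ^ q \<noteq> t" "t ^ (q\<^sup>2) \<noteq> t" "t ^ (q\<^sup>2) \<noteq> t ^ q"
proof -
  have "card (subfld q 1 :: 'a set) < card (subfld q 3 :: 'a set)"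
    using q_gt_1 by (simp add: card_subfld power_strict_increasing[of 1 3 q, simplified])
  then obtain t :: 'a where t: "t \<in> subfld q 3" "t \<notin> subfld q 1"
    by (metis card_mono finite_class.finite linorder_not_le subsetI)
  hence 1: "t ^ q \<noteq> t" using subfld_1_iff by blast
  have t3: "((t ^ q) ^ q) ^ q = t" using t by (simp add: subfld_def pow_q3)
  have "t ^ (q\<^sup>2) \<noteq> t ^ q"
    using 1 by (simp add: pow_q2 inj_pow)
  moreover have "t ^ (q\<^sup>2) \<noteq> t"
    using 1 t3 unfolding pow_q2 by metis
  ultimately show ?thesis using that t 1 by blast
qed

text \<open>The trace polynomial X + X^q + X^(q^2) has degree q^2, hence too few roots to vanish on
  all q^3 elements; \<open>\<tau>\<close> is a non-root divided by \<open>\<theta>\<close>.\<close>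

lemma trace_nonzero:
  assumes "(\<theta> :: 'a) \<in> subfld q 3" "\<theta> \<noteq> 0"
  obtains \<tau> where "\<tau> \<in> subfld q 3" "\<tau> * \<theta> + (\<tau> * \<theta>) ^ q + (\<tau> * \<theta>) ^ (q\<^sup>2) \<noteq> 0"
proof -
  define p where "p = monom (1 :: 'a) 1 + monom 1 q + monom 1 (q\<^sup>2)"
  have q2: "q < q\<^sup>2" using q_gt_1 by (simp add: power2_eq_square)
  have "coeff p (q\<^sup>2) = 1"
    using q2 q_gt_1 by (simp add: p_def)
  hence "p \<noteq> 0" by auto
  have "degree p \<le> q\<^sup>2"
    unfolding p_def using q2 q_gt_1
    by (intro degree_add_le) (auto intro!: order.trans[OF degree_monom_le])
  hence "card {x. poly p x = 0} \<le> q\<^sup>2"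
    using card_poly_roots_bound[OF \<open>p \<noteq> 0\<close>] by linarith
  also have "q\<^sup>2 < q ^ 3" using q_gt_1 by (simp add: power_strict_increasing)
  also have "q ^ 3 = card (subfld q 3 :: 'a set)" by (simp add: card_subfld)
  finally obtain x where x: "x \<in> subfld q 3" "poly p x \<noteq> 0"
    by (metis (mono_tags, lifting) card_mono finite_class.finite linorder_not_le mem_Collect_eq subsetI)
  show ?thesis
    by (rule that[of "x / \<theta>"]) (use x assms in \<open>auto simp: subfld_closed p_def poly_monom\<close>)
qed

text \<open>
  Counting replaces the construction of a splitting field: the pairs (sum, product) coming from
  conjugate elements outside the field \<open>F\<close> of order \<open>q\<close>, from distinct elements of \<open>F\<close> and from
  repeated elements of \<open>F\<close> are pairwise different and exhaust \<open>F \<times> F\<close>.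
\<close>

lemma quadratic_splits:
  assumes b: "(b :: 'a) \<in> subfld q 1" and c: "c \<in> subfld q 1"
  obtains r r' where "\<And>t. t\<^sup>2 + b * t + c = (t - r) * (t - r')"
    and "r \<in> subfld q 1 \<and> r' \<in> subfld q 1 \<or> r' = r ^ q \<and> r = r' ^ q \<and> r \<noteq> r'"
proof -
  define F where "F = (subfld q 1 :: 'a set)"
  define G where "G = (subfld q 2 :: 'a set) - F"
  define D where "D = {(a, b). a \<in> F \<and> b \<in> F \<and> a \<noteq> b}"
  define fz where "fz = (\<lambda>z::'a. (z + z ^ q, z * z ^ q))"
  define fpr where "fpr = (\<lambda>(a, b). (a + b, a * b :: 'a))"
  define S where "S = fz ` G"
  define T where "T = fpr ` D"
  define U where "U = fz ` F"
  have cF: "card F = q" and cF2: "card (subfld q 2 :: 'a set) = q\<^sup>2"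
    using card_subfld[of 1] card_subfld[of 2] by (simp_all add: F_def)
  have FF: "a ^ q = a" if "a \<in> F" for a
    using that subfld_1_iff[of a] by (simp add: F_def)
  have "F \<subseteq> subfld q 2" unfolding F_def using subfld_1_imp by blast
  hence cG: "card G = q\<^sup>2 - q"
    by (simp add: G_def cF cF2 card_Diff_subset)
  have GG: "(z ^ q) ^ q = z" if "z \<in> G" for z
    using that by (auto simp: G_def subfld_def pow_q2)
  have GF: "z ^ q \<noteq> z" if "z \<in> G" for z
    using that subfld_1_iff[of z] by (simp add: G_def F_def)
  have cD: "card D = q\<^sup>2 - q"
  proof -
    have "D = F \<times> F - (\<lambda>a. (a, a)) ` F" by (auto simp: D_def)
    moreover have "card ((\<lambda>a. (a, a)) ` F) = q"
      by (subst card_image) (auto simp: inj_on_def cF)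
    ultimately show ?thesis
      by (simp add: card_Diff_subset image_subset_iff card_cartesian_product cF power2_eq_square)
  qed
  have key: "x = a \<and> y = b \<or> x = b \<and> y = a" if "x + y = a + b" "x * y = a * b" for x y a b :: 'a
  proof -
    have "(x - a) * (x - b) = x * x - (a + b) * x + a * b" by (simp add: algebra_simps)
    also have "\<dots> = 0" unfolding that[symmetric] by (simp add: algebra_simps)
    finally have "x = a \<or> x = b" by simp
    thus ?thesis using that(1) by auto
  qed
  have "card G \<le> 2 * card S"
    unfolding S_def
  proof (rule card_image_fibre_le)
    fix z assume "z \<in> G"
    thus "card {x \<in> G. fz x = fz z} \<le> 2"
      using key[of _ _ z "z ^ q"] by (intro card_le_two[of _ G z "z ^ q"]) (auto simp: fz_def)
  qed auto
  moreover have "card D \<le> 2 * card T"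
    unfolding T_def
  proof (rule card_image_fibre_le)
    fix z assume "z \<in> D"
    thus "card {x \<in> D. fpr x = fpr z} \<le> 2"
      using key[of _ _ "fst z" "snd z"]
      by (intro card_le_two[of _ D z "(snd z, fst z)"]) (auto simp: fpr_def case_prod_unfold prod_eq_iff)
  qed auto
  moreover have "card U = q"
    unfolding U_def cF[symmetric]
  proof (rule card_image, rule inj_onI)
    fix x y assume "x \<in> F" "y \<in> F" "fz x = fz y"
    thus "x = y" using key[of x x y y] by (simp add: fz_def FF)
  qed
  moreover have "card (S \<union> T \<union> U) = card S + card T + card U"
  proof -
    have "S \<inter> T = {}"
    proof (rule ccontr)
      assume "S \<inter> T \<noteq> {}"
      then obtain z a b where h: "z \<in> G" "a \<in> F" "b \<in> F" "z + z ^ q = a + b" "z * z ^ q = a * b"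
        by (fastforce simp: S_def T_def fz_def fpr_def D_def)
      hence "z = a \<or> z = b" using key by blast
      with h show False by (auto simp: G_def)
    qed
    moreover have "S \<inter> U = {}"
    proof (rule ccontr)
      assume "S \<inter> U \<noteq> {}"
      then obtain z a where h: "z \<in> G" "a \<in> F" "z + z ^ q = a + a" "z * z ^ q = a * a"
        by (fastforce simp: S_def U_def fz_def FF)
      hence "z = a" using key by blast
      with h show False by (auto simp: G_def)
    qed
    moreover have "T \<inter> U = {}"
    proof (rule ccontr)
      assume "T \<inter> U \<noteq> {}"
      then obtain z a b where h: "z \<in> F" "a \<noteq> b" "z + z = a + b" "z * z = a * b"
        by (fastforce simp: U_def T_def fz_def fpr_def D_def FF)
      hence "z = a \<and> z = b" using key by blast
      with h show False by auto
    qed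
    ultimately show ?thesis
      by (subst card_Un_disjoint) (auto simp: card_Un_disjoint)
  qed
  \<comment> \<open>\<open>G\<close> and \<open>D\<close> have q^2 - q elements each and their
    fibres at most 2, so the three disjoint images contain at least (q^2 - q) / 2 + (q^2 - q) / 2 +
    q = q^2 pairs.\<close>
  ultimately have "q\<^sup>2 \<le> card (S \<union> T \<union> U)"
    using cG cD q_gt_1 by (auto simp: power2_eq_square)
  moreover have sub: "S \<union> T \<union> U \<subseteq> F \<times> F"
  proof -
    have "S \<subseteq> F \<times> F"
      unfolding S_def fz_def
      by (auto simp: GG F_def subfld_1_iff[unfolded One_nat_def] add_pow power_mult_distrib algebra_simps)
    moreover have "T \<subseteq> F \<times> F"
      unfolding T_def fpr_def D_def by (auto simp: F_def subfld_closed)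
    moreover have "U \<subseteq> F \<times> F"
      unfolding U_def fz_def by (auto simp: F_def subfld_closed)
    ultimately show ?thesis by blast
  qed
  moreover have "card (F \<times> F) = q\<^sup>2" by (simp add: card_cartesian_product cF power2_eq_square)
  ultimately have "S \<union> T \<union> U = F \<times> F"
    by (intro card_seteq) simp_all
  moreover have "(- b, c) \<in> F \<times> F"
    using b c by (auto simp: F_def subfld_closed simp del: One_nat_def)
  ultimately have "(- b, c) \<in> S \<union> T \<union> U" by simp
  then consider z where "z \<in> G" "- b = z + z ^ q" "c = z * z ^ q"
    | x y where "x \<in> F" "y \<in> F" "- b = x + y" "c = x * y"
    by (auto simp: S_def T_def U_def fz_def fpr_def D_def FF)
  thus ?thesis
  proof cases
    case 1
    have bb: "b = - (z + z ^ q)" using 1 by (metis minus_minus)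
    show ?thesis
      by (rule that[of z "z ^ q"])
        (use 1(3) GG[OF 1(1)] not_sym[OF GF[OF 1(1)]] in \<open>auto simp: bb power2_eq_square algebra_simps\<close>)
  next
    case 2
    have bb: "b = - (x + y)" using 2 by (metis minus_minus)
    show ?thesis
      by (rule that[of x y])
        (use 2 in \<open>auto simp: bb F_def power2_eq_square algebra_simps\<close>)
  qed
qed

end

section \<open>Frobenius on vectors and matrices\<close>

definition fmat :: "nat \<Rightarrow> 'a::field ^ 'm ^ 'n \<Rightarrow> 'a ^ 'm ^ 'n" where
  "fmat n A = (\<chi> i. frob n (A $ i))"

lemma image_span_singleton: "(*v) A ` vec.span {v} = vec.span {A *v v}"
  by (simp add: vec.linear_span_image[OF matrix_vector_mul_linear_gen, symmetric])

lemma span_singleton_eq_iff: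
  fixes u v :: "'a::field ^ 'n"
  shows "vec.span {u} = vec.span {v} \<longleftrightarrow> (\<exists>c. c \<noteq> 0 \<and> u = c *s v)"
proof
  assume h: "vec.span {u} = vec.span {v}"
  hence "u \<in> vec.span {v}" "v \<in> vec.span {u}"
    by (metis insertI1 vec.span_base, metis insertI1 vec.span_base h)
  then obtain c d where "u = c *s v" "v = d *s u"
    unfolding vec.span_singleton by blast
  thus "\<exists>c. c \<noteq> 0 \<and> u = c *s v"
    by (cases "c = 0") (simp add: exI[of _ 1], blast)
next
  assume "\<exists>c. c \<noteq> 0 \<and> u = c *s v"
  then obtain c where c: "c \<noteq> 0" "u = c *s v" by blast
  have "k *s v = (k / c) *s u" for k using c by simp
  thus "vec.span {u} = vec.span {v}"
    unfolding vec.span_singleton using c by (auto simp: image_iff) (metis nonzero_eq_divide_eq)+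
qed

lemma invertible_inv_mult:
  assumes "invertible A"
  shows "A ** matrix_inv A = mat 1" "matrix_inv A ** A = mat 1"
  using assms unfolding invertible_def matrix_inv_def by (metis (mono_tags, lifting) someI_ex)+

lemma invertible_inv_vec:
  fixes A :: "'a::field ^ 'n ^ 'm"
  assumes "invertible A"
  shows "A *v (matrix_inv A *v x) = x" "matrix_inv A *v (A *v y) = y"
  by (simp_all add: matrix_vector_mul_assoc invertible_inv_mult[OF assms])

lemma vector_scalar_mult_commute: "(A :: 'a::field ^ 'm ^ 'n) *v (c *s v) = c *s (A *v v)"
  by (rule vec.scale)

lemma quad_scale: "quad A (c *s x) = c\<^sup>2 * quad A x"
  by (simp add: quad_def sum_distrib_left power2_eq_square mult_ac)

lemma polar_expand:
  "polar A x y = (\<Sum>i\<in>UNIV. \<Sum>j\<in>UNIV. A $ i $ j * (x $ i * y $ j + y $ i * x $ j))"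
  by (simp add: polar_def quad_def sum_subtractf[symmetric] algebra_simps)

lemma polar_linear:
  "polar A x (y + z) = polar A x y + polar A x z"
  "polar A x (c *s y) = c * polar A x y"
  "polar A x y = polar A y x"
  "polar A x x = 2 * quad A x"
  "polar A x (- y) = - polar A x y"
  "polar A x (y - z) = polar A x y - polar A x z"
  by (simp_all add: polar_expand quad_def sum.distrib[symmetric] sum_distrib_left algebra_simps
      sum_negf[symmetric] sum_subtractf[symmetric])

lemma quad_add: "quad A (x + y) = quad A x + quad A y + polar A x y"
  by (simp add: polar_def)

lemma quad_sum_row: "quad A x = (\<Sum>i\<in>UNIV. x $ i * (A *v x) $ i)"
  by (simp add: quad_def matrix_vector_mult_def sum_distrib_left mult_ac)

lemma quad_compose:
  fixes R :: "'a::field ^ 'n ^ 'm"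
  shows "quad (transpose R ** A ** R) x = quad A (R *v x)"
proof -
  have tr: "(transpose R *v y) $ i = (\<Sum>j\<in>UNIV. R $ j $ i * y $ j)" for y i
    by (simp only: matrix_vector_mult_def transpose_def vec_lambda_beta)
  have "quad (transpose R ** A ** R) x = (\<Sum>i\<in>UNIV. x $ i * (transpose R *v (A *v (R *v x))) $ i)"
    by (simp only: quad_sum_row matrix_vector_mul_assoc matrix_mul_assoc)
  also have "\<dots> = (\<Sum>i\<in>UNIV. \<Sum>j\<in>UNIV. x $ i * (R $ j $ i * (A *v (R *v x)) $ j))"
    by (simp only: tr sum_distrib_left)
  also have "\<dots> = (\<Sum>j\<in>UNIV. \<Sum>i\<in>UNIV. x $ i * (R $ j $ i * (A *v (R *v x)) $ j))"
    by (rule sum.swap)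
  also have "\<dots> = (\<Sum>j\<in>UNIV. (R *v x) $ j * (A *v (R *v x)) $ j)"
    by (simp add: matrix_vector_mult_def[of R] sum_distrib_right mult_ac)
  finally show ?thesis by (simp add: quad_sum_row)
qed

lemma polar_compose: "polar (transpose R ** A ** R) x y = polar A (R *v x) (R *v y)"
  by (simp add: polar_def quad_compose matrix_vector_right_distrib)

lemma quadric_points_iff:
  "P \<in> quadric_points q k A \<longleftrightarrow>
    (\<exists>v. P = vec.span {v} \<and> v \<in> vecs_over q k \<and> v \<noteq> 0 \<and> quad A v = 0)"
proof -
  have "(\<forall>x\<in>vec.span {v}. quad A x = 0) \<longleftrightarrow> quad A v = 0" for v
    by (auto simp: vec.span_singleton quad_scale intro: vec.span_base)
  thus ?thesis unfolding quadric_points_def PG_def by auto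
qed

lemma points_iff:
  assumes "vec.subspace W"
  shows "P \<in> points q k W \<longleftrightarrow>
    (\<exists>v. P = vec.span {v} \<and> v \<in> vecs_over q k \<and> v \<noteq> 0 \<and> v \<in> W)"
proof -
  have "vec.span {v} \<subseteq> W \<longleftrightarrow> v \<in> W" for v
    using assms vec.span_minimal[of "{v}" W] vec.span_base[of v "{v}"] by auto
  thus ?thesis unfolding points_def PG_def by auto
qed

context tower
begin

lemma frob_add: "qpow n \<Longrightarrow> frob n (u + v :: 'a ^ 'n) = frob n u + frob n v"
  by (simp add: frob_def vec_eq_iff add_pow)

lemma frob_scale: "frob n (c *s (v :: 'a ^ 'n)) = c ^ n *s frob n v"
  by (simp add: frob_def vec_eq_iff power_mult_distrib)

lemma frob_mult_vec: "qpow n \<Longrightarrow> frob n ((A :: 'a ^ 'm ^ 'n) *v v) = fmat n A *v frob n v"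
  by (simp add: frob_def vec_eq_iff fmat_def matrix_vector_mult_def sum_pow power_mult_distrib)

lemma fmat_mult: "qpow n \<Longrightarrow> fmat n ((A :: 'a ^ 'm ^ 'n) ** B) = fmat n A ** fmat n B"
  by (simp add: frob_def vec_eq_iff fmat_def matrix_matrix_mult_def sum_pow power_mult_distrib)

lemma fmat_one: "qpow n \<Longrightarrow> fmat n (mat 1 :: 'a ^ 'n ^ 'n) = mat 1"
  using qpow_pos[of n] by (simp add: frob_def vec_eq_iff fmat_def mat_def)

lemma frob_eq_iff: "qpow n \<Longrightarrow> frob n (u :: 'a ^ 'n) = frob n v \<longleftrightarrow> u = v"
  by (simp add: frob_def vec_eq_iff inj_pow)

lemma frob_0: "qpow n \<Longrightarrow> frob n (0 :: 'a ^ 'n) = 0"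
  using qpow_pos[of n] by (simp add: frob_def vec_eq_iff)

lemma frob_frob: "frob m (frob n (v :: 'a ^ 'n)) = frob (n * m) v"
  by (simp add: frob_def vec_eq_iff power_mult)

lemma vecs_over_iff: "(v :: 'a ^ 'n) \<in> vecs_over q k \<longleftrightarrow> frob (q ^ k) v = v"
  by (simp add: vecs_over_def subfld_def frob_def vec_eq_iff)

lemma mat_over_iff: "mat_over q k (A :: 'a ^ 'm ^ 'n) \<longleftrightarrow> fmat (q ^ k) A = A"
  by (simp add: mat_over_def subfld_def frob_def fmat_def vec_eq_iff)

lemma vecs_over_6: "(v :: 'a ^ 'n) \<in> vecs_over q 6"
  by (simp add: vecs_over_def subfld_6)

lemma mat_over_6: "mat_over q 6 (A :: 'a ^ 'm ^ 'n)"
  by (simp add: mat_over_def subfld_6)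

lemma vecs_over_1_imp: "(v :: 'a ^ 'n) \<in> vecs_over q 1 \<Longrightarrow> v \<in> vecs_over q k"
  unfolding vecs_over_def using subfld_1_imp by blast

lemma mat_over_1_imp: "mat_over q 1 (A :: 'a ^ 'm ^ 'n) \<Longrightarrow> mat_over q k A"
  unfolding mat_over_def using subfld_1_imp by blast

lemma mat_over_mult: "mat_over q k (A :: 'a ^ 'm ^ 'n) \<Longrightarrow> mat_over q k B \<Longrightarrow> mat_over q k (A ** B)"
  by (simp add: mat_over_iff fmat_mult)

lemma mat_over_mult_vec:
  "mat_over q k (A :: 'a ^ 'm ^ 'n) \<Longrightarrow> v \<in> vecs_over q k \<Longrightarrow> A *v v \<in> vecs_over q k"
  by (simp add: mat_over_iff vecs_over_iff frob_mult_vec)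

lemma mat_over_transpose: "mat_over q k (A :: 'a ^ 'm ^ 'n) \<Longrightarrow> mat_over q k (transpose A)"
  by (simp add: mat_over_def transpose_def)

text \<open>Frobenius fixes \<open>A\<close>, so it turns the inverse of \<open>A\<close> into a
  left inverse of \<open>A\<close>, which is unique.\<close>

lemma mat_over_inv:
  assumes "mat_over q k (A :: 'a ^ 'n ^ 'n)" "invertible A"
  shows "mat_over q k (matrix_inv A)"
proof -
  let ?B = "fmat (q ^ k) (matrix_inv A)"
  have "?B ** A = fmat (q ^ k) (matrix_inv A ** A)"
    using assms(1) by (simp add: fmat_mult mat_over_iff)
  also have "\<dots> = mat 1"
    by (simp add: invertible_inv_mult[OF assms(2)] fmat_one)
  finally have "?B ** A ** matrix_inv A = matrix_inv A" by simp
  thus ?thesis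
    by (simp add: mat_over_iff invertible_inv_mult[OF assms(2)] flip: matrix_mul_assoc)
qed

lemma vecs_over_closed:
  assumes "(u :: 'a ^ 'n) \<in> vecs_over q k"
  shows "v \<in> vecs_over q k \<Longrightarrow> u + v \<in> vecs_over q k" "v \<in> vecs_over q k \<Longrightarrow> u - v \<in> vecs_over q k"
    "c \<in> subfld q k \<Longrightarrow> c *s u \<in> vecs_over q k"
  using assms by (auto simp: vecs_over_def subfld_closed)

lemma axis_over: "axis i (1 :: 'a) \<in> vecs_over q k"
  by (auto simp: vecs_over_def axis_def)

lemma quad_over:
  assumes "mat_over q k (A :: 'a ^ 'n ^ 'n)" "v \<in> vecs_over q k"
  shows "quad A v \<in> subfld q k"
proof -
  have "(\<Sum>i\<in>I. g i) \<in> subfld q k" if "\<And>i. g i \<in> subfld q k" for I and g :: "'n \<Rightarrow> 'a"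
    using that by (induction I rule: infinite_finite_induct) (auto simp: subfld_closed)
  thus ?thesis
    using assms unfolding quad_def mat_over_def vecs_over_def by (auto simp: subfld_closed)
qed

lemma polar_over:
  assumes "mat_over q k (A :: 'a ^ 'n ^ 'n)" "v \<in> vecs_over q k" "w \<in> vecs_over q k"
  shows "polar A v w \<in> subfld q k"
  using assms by (simp add: polar_def subfld_closed quad_over vecs_over_closed)

end

section \<open>Normal form of a conic\<close>

text \<open>The form x_1 x_3 - x_2^2. Its mixed coefficient sits in a single entry, because
  splitting it symmetrically would require division by 2.\<close>

definition std_conic :: "'a::field ^ 3 ^ 3" where
  "std_conic = (\<chi> i j. if i = 1 \<and> j = 3 then 1 else if i = 2 \<and> j = 2 then -1 else 0)"

lemma polar_scale_left: "polar A (c *s x) y = c * polar A x y"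
  by (simp add: polar_expand sum_distrib_left algebra_simps)

lemma quad_std_conic: "quad std_conic x = x $ 1 * x $ 3 - (x $ 2)\<^sup>2"
  by (simp add: quad_def sum_3 std_conic_def power2_eq_square)

lemma polar_std_conic: "polar std_conic x y = x $ 1 * y $ 3 + x $ 3 * y $ 1 - 2 * x $ 2 * y $ 2"
  by (simp add: polar_expand sum_3 std_conic_def algebra_simps)

text \<open>In characteristic two the polar form has the radical spanned by (0, 1, 0), but that
  vector is not on the conic: a point of the conic has a nonzero first or third entry, which one of
  the two outer basis vectors detects.\<close>

lemma std_conic_nondegenerate:
  assumes "x \<noteq> 0" "quad std_conic x = 0"
  obtains y where "polar std_conic x y \<noteq> 0"
proof (cases "x $ 1 = 0")
  case True
  hence "x $ 2 = 0" using assms(2) by (simp add: quad_std_conic)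
  hence "x $ 3 \<noteq> 0" using True assms(1) by (auto simp: vec_eq_iff forall_3)
  thus ?thesis by (intro that[of "vector [1, 0, 0]"]) (simp add: polar_std_conic)
next
  case False
  thus ?thesis by (intro that[of "vector [0, 0, 1]"]) (simp add: polar_std_conic)
qed

lemma std_conic_points:
  assumes "quad std_conic x = 0"
  obtains c where "x = c *s vector [1, x $ 2 / x $ 1, (x $ 2 / x $ 1)\<^sup>2]" "x $ 1 \<noteq> 0"
  | c where "x = c *s vector [0, 0, 1]"
proof (cases "x $ 1 = 0")
  case True
  hence "x $ 2 = 0" using assms(1) by (simp add: quad_std_conic)
  thus ?thesis using True by (intro that(2)[of "x $ 3"]) (simp add: vec_eq_iff forall_3)
next
  case False
  thus ?thesis using assms
    by (intro that(1)[of "x $ 1"])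
      (simp_all add: vec_eq_iff forall_3 quad_std_conic power2_eq_square divide_simps mult.commute)
qed

text \<open>An isotropic \<open>e\<close> and a partner \<open>w\<close> with polar value 1 are
  independent. The completing vector is taken from the standard basis so that it is rational over
  every subfield.\<close>

lemma nondegenerate_basis:
  fixes e w :: "'a::field ^ 3"
  assumes e: "e \<noteq> 0" "quad A e = 0" and w: "quad A w = 0" "polar A e w = 1"
  obtains i where "vec.span {axis i 1, w, e} = UNIV"
proof -
  have we: "w \<notin> vec.span {e}"
    using w(2) e(2) by (auto simp: vec.span_singleton polar_linear)
  have e0: "e \<notin> vec.span {}" using e(1) by simp
  have d2: "vec.dim {w, e} = 2"
    using we e0 by (simp add: vec.dim_insert)
  have "\<exists>i. axis i 1 \<notin> vec.span {w, e}"
  proof (rule ccontr)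
    assume "\<nexists>i. axis i 1 \<notin> vec.span {w, e}"
    hence "cart_basis \<subseteq> vec.span {w, e}" by (auto simp: cart_basis_def)
    hence "vec.span {w, e} = UNIV"
      by (metis span_cart_basis vec.span_mono vec.span_span top.extremum_unique)
    hence "vec.dim {w, e} = 3"
      using vec.dim_span[of "{w, e}"] vec_dim_card[where 'a = 'a and 'n = 3] by simp
    thus False using d2 by simp
  qed
  then obtain i where i: "axis i 1 \<notin> vec.span {w, e}" by blast
  have "vec.dim {axis i 1, w, e} = 3"
    using i d2 by (simp add: vec.dim_insert)
  hence "vec.span {axis i 1, w, e} = UNIV"
    using vec.subspace_dim_equal[of "vec.span {axis i 1, w, e}" UNIV] by (simp del: vec.dim_UNIV add: vec_dim_card)
  thus ?thesis using that by blast
qed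

section \<open>Rational points and normal form of ternary quadratic forms over the field of order
  q\<close>

context tower
begin

text \<open>Squaring is at most two-to-one on the q - 1 nonzero elements, and 0 adds one more
  square. Two sets of this size in a field of q elements cannot be disjoint.\<close>

lemma card_squares: "q + 1 \<le> 2 * card ((\<lambda>x. x\<^sup>2) ` (subfld q 1 :: 'a set))"
proof -
  define G where "G = (subfld q 1 :: 'a set) - {0}"
  have cF: "card (subfld q 1 :: 'a set) = q" using card_subfld[of 1] by simp
  have "card G = q - 1" by (simp add: G_def cF[unfolded One_nat_def])
  moreover have "card G \<le> 2 * card ((\<lambda>x. x\<^sup>2) ` G)"
  proof (rule card_image_fibre_le)
    fix z show "card {x \<in> G. x\<^sup>2 = z\<^sup>2} \<le> 2"
      by (rule card_le_two[of _ G z "- z"]) (auto simp: power2_eq_iff)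
  qed auto
  moreover have "(\<lambda>x. x\<^sup>2) ` subfld q 1 = insert 0 ((\<lambda>x. x\<^sup>2) ` G)"
    by (auto simp: G_def image_iff intro: bexI[of _ 0])
  moreover have "0 \<notin> (\<lambda>x. x\<^sup>2) ` G" by (auto simp: G_def)
  ultimately show ?thesis using q_gt_1 by simp
qed

text \<open>
  With \<open>D\<close>, \<open>m\<close>, \<open>E\<close> as in the proof, completing squares gives \<open>4 a D f(x, y, 1) = D u\<^sup>2 + w\<^sup>2 + E\<close>, and
  the values of \<open>D u\<^sup>2\<close> and of \<open>- E - w\<^sup>2\<close> are too many to be disjoint.
\<close>

lemma isotropic_char_not_2:
  fixes a b c d e g :: 'a
  assumes F: "a \<in> subfld q 1" "b \<in> subfld q 1" "c \<in> subfld q 1" "d \<in> subfld q 1" "e \<in> subfld q 1" "g \<in> subfld q 1"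
    and two: "(2 :: 'a) \<noteq> 0"
  shows "\<exists>x\<in>subfld q 1. \<exists>y\<in>subfld q 1. \<exists>z\<in>subfld q 1. (x, y, z) \<noteq> (0, 0, 0) \<and>
    a * x\<^sup>2 + b * y\<^sup>2 + c * z\<^sup>2 + d * x * y + e * x * z + g * y * z = 0"
  (is "\<exists>x\<in>_. \<exists>y\<in>_. \<exists>z\<in>_. _ \<and> ?Q x y z = 0")
proof -
  define D where "D = 4 * a * b - d\<^sup>2"
  define m where "m = 2 * a * g - d * e"
  define E where "E = D * (4 * a * c - e\<^sup>2) - m\<^sup>2"
  define F where "F = (subfld q 1 :: 'a set)"
  have nums: "(2 :: 'a) \<in> F" "(4 :: 'a) \<in> F"
    using subfld_closed(1)[of 1 1 1] subfld_closed(1)[of 2 1 2] by (simp_all add: F_def)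
  have wit: ?thesis
    if "x \<in> F" "y \<in> F" "z \<in> F" "(x, y, z) \<noteq> (0, 0, 0)" "?Q x y z = 0" for x y z
    using that unfolding F_def by blast
  note cl = subfld_closed[where k = 1, folded F_def]
  note F = F[folded F_def]
  have DF: "D \<in> F" unfolding D_def by (intro cl F nums)
  have mF: "m \<in> F" unfolding m_def by (intro cl F nums)
  have EF: "E \<in> F" unfolding E_def by (intro cl F nums DF mF)
  have F01: "0 \<in> F" "1 \<in> F" by (simp_all add: F_def)
  consider "a = 0" | "a \<noteq> 0" "D = 0" | "a \<noteq> 0" "D \<noteq> 0" by blast
  thus ?thesis
  proof cases
    case 1
    thus ?thesis using F01 by (intro wit[of 1 0 0]) auto
  next
    case 2
    \<comment> \<open>For z = 0, 4 a times the form is (2 a x + d y)^2 + D y^2. With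
      \<open>D = 0\<close> only the square is left, and it vanishes at (-d, 2 a).\<close>
    have "a * (- d)\<^sup>2 + b * (2 * a)\<^sup>2 + d * (- d) * (2 * a) = a * D"
      by (simp add: D_def power2_eq_square algebra_simps)
    thus ?thesis using 2 two
      by (intro wit[of "- d" "2 * a" 0]) (auto intro!: cl F nums F01)
  next
    case 3
    define S where "S = (\<lambda>x. D * x) ` (\<lambda>x. x\<^sup>2) ` F"
    define T where "T = (\<lambda>x. - E - x) ` (\<lambda>x. x\<^sup>2) ` F"
    have "card S = card ((\<lambda>x. x\<^sup>2) ` F)" "card T = card ((\<lambda>x. x\<^sup>2) ` F)"
      unfolding S_def T_def by (rule card_image; use 3 in \<open>simp add: inj_on_def\<close>)+
    hence "q + 1 \<le> card S + card T" using card_squares by (simp add: F_def)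
    moreover have "S \<union> T \<subseteq> F"
      unfolding S_def T_def using DF EF by (auto intro!: cl)
    hence "card (S \<union> T) \<le> q"
      using card_mono[of F "S \<union> T"] card_subfld[of 1] by (simp add: F_def)
    ultimately have "S \<inter> T \<noteq> {}"
      using card_Un_disjoint[of S T] by auto
    then obtain u w where uw: "u \<in> F" "w \<in> F" "D * u\<^sup>2 = - E - w\<^sup>2"
      by (auto simp: S_def T_def)
    define y where "y = (w - m) / D"
    define x where "x = (u - d * y - e) / (2 * a)"
    have yF: "y \<in> F" unfolding y_def by (intro cl uw mF DF)
    have xF: "x \<in> F" unfolding x_def by (intro cl uw F yF nums)
    have u: "u = 2 * a * x + d * y + e" using 3 two by (simp add: x_def)
    have w: "w = D * y + m" using 3 by (simp add: y_def)
    have "4 * a * D * (a * x\<^sup>2 + b * y\<^sup>2 + c + d * x * y + e * x + g * y)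
      = D * (2 * a * x + d * y + e)\<^sup>2 + D * (D * y\<^sup>2 + 2 * m * y) + D * (4 * a * c - e\<^sup>2)"
      by (simp add: D_def m_def power2_eq_square algebra_simps)
    also have "\<dots> = D * u\<^sup>2 + w\<^sup>2 + E"
      unfolding u w E_def by (simp add: power2_eq_square algebra_simps)
    also have "\<dots> = 0" using uw(3) by simp
    finally have "4 * a * D * (a * x\<^sup>2 + b * y\<^sup>2 + c + d * x * y + e * x + g * y) = 0" .
    moreover have "(4 :: 'a) \<noteq> 0" using two by (metis mult_eq_0_iff numeral_Bit0 mult_2 one_add_one)
    ultimately show ?thesis using 3 xF yF F01
      by (intro wit[of x y 1]) auto
  qed
qed

text \<open>
  In characteristic two \<open>(g, e, d)\<close> lies in the radical of the polar form, so adding a multiple of it to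
  a vector changes the value of the form by an arbitrary multiple of \<open>f(g, e, d)\<close>, all elements being squares.
\<close>

lemma isotropic_char_2:
  fixes a b c d e g :: 'a
  assumes F: "a \<in> subfld q 1" "b \<in> subfld q 1" "c \<in> subfld q 1" "d \<in> subfld q 1" "e \<in> subfld q 1" "g \<in> subfld q 1"
    and two: "(2 :: 'a) = 0"
  shows "\<exists>x\<in>subfld q 1. \<exists>y\<in>subfld q 1. \<exists>z\<in>subfld q 1. (x, y, z) \<noteq> (0, 0, 0) \<and>
    a * x\<^sup>2 + b * y\<^sup>2 + c * z\<^sup>2 + d * x * y + e * x * z + g * y * z = 0"
  (is "\<exists>x\<in>_. \<exists>y\<in>_. \<exists>z\<in>_. _ \<and> ?Q x y z = 0")
proof -
  define F where "F = (subfld q 1 :: 'a set)"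
  have wit: ?thesis
    if "x \<in> F" "y \<in> F" "z \<in> F" "(x, y, z) \<noteq> (0, 0, 0)" "?Q x y z = 0" for x y z
    using that unfolding F_def by blast
  note cl = subfld_closed[where k = 1, folded F_def]
  note F = F[folded F_def]
  have F01: "0 \<in> F" "1 \<in> F" by (simp_all add: F_def)
  have dbl: "x + x = 0" for x :: 'a using two by (metis mult_2 mult_zero_left)
  have neg: "- x = x" for x :: 'a using dbl[of x] by (simp add: eq_neg_iff_add_eq_0 minus_unique)
  have "inj_on (\<lambda>x. x\<^sup>2) F"
    by (auto simp: inj_on_def power2_eq_iff neg)
  moreover have "(\<lambda>x. x\<^sup>2) ` F \<subseteq> F" by (auto intro: cl)
  ultimately have sq: "(\<lambda>x. x\<^sup>2) ` F = F" by (intro endo_inj_surj) auto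
  have sqrt: "\<exists>y\<in>F. y\<^sup>2 = x" if "x \<in> F" for x
    using that sq by (metis imageE)
  define f where "f = a * g\<^sup>2 + b * e\<^sup>2 + c * d\<^sup>2 + d * g * e + e * g * d + g * e * d"
  have fF: "f \<in> F" unfolding f_def by (intro cl F)
  have shift: "a * (x + k * g)\<^sup>2 + b * (y + k * e)\<^sup>2 + c * (z + k * d)\<^sup>2 + d * (x + k * g) * (y + k * e)
      + e * (x + k * g) * (z + k * d) + g * (y + k * e) * (z + k * d)
    = (a * x\<^sup>2 + b * y\<^sup>2 + c * z\<^sup>2 + d * x * y + e * x * z + g * y * z) + k\<^sup>2 * f" for x y z k
  proof -
    have "a * (x + k * g)\<^sup>2 + b * (y + k * e)\<^sup>2 + c * (z + k * d)\<^sup>2 + d * (x + k * g) * (y + k * e)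
      + e * (x + k * g) * (z + k * d) + g * (y + k * e) * (z + k * d)
    = (a * x\<^sup>2 + b * y\<^sup>2 + c * z\<^sup>2 + d * x * y + e * x * z + g * y * z) + k\<^sup>2 * f
      + 2 * k * (a * g * x + b * e * y + c * d * z + d * e * x + d * g * y + e * g * z)"
      by (simp add: f_def power2_eq_square algebra_simps)
    thus ?thesis by (simp add: two)
  qed
  consider "a = 0" | "a \<noteq> 0" "d = 0" "e = 0" "g = 0" | "f = 0" "(d, e, g) \<noteq> (0, 0, 0)"
    | "f \<noteq> 0" "(d, e) \<noteq> (0, 0)" | "f \<noteq> 0" "d = 0" "e = 0" "g \<noteq> 0" by auto
  thus ?thesis
  proof cases
    case 1
    thus ?thesis using F01 by (intro wit[of 1 0 0]) auto
  next
    case 2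
    \<comment> \<open>The form has no mixed terms here, and the roots of \<open>b\<close> and
      \<open>a\<close> give the value a b + b a = 0.\<close>
    obtain r s where "r \<in> F" "r\<^sup>2 = b" "s \<in> F" "s\<^sup>2 = a"
      using sqrt[OF F(2)] sqrt[OF F(1)] by blast
    thus ?thesis using F01 2 dbl[of "a * b"]
      by (intro wit[of r s 0]) (auto simp: mult.commute)
  next
    case 3
    thus ?thesis using F shift[of 0 1 0 0]
      by (intro wit[of g e d]) auto
  next
    case 4
    \<comment> \<open>Shifting (1, 0, 0) by \<open>k\<close> times the radical vector gives the
      value a + k^2 f = 2 a = 0.\<close>
    obtain k where k: "k \<in> F" "k\<^sup>2 = a / f" using sqrt[OF cl(4)[OF F(1) fF]] by blast
    have "(1 + k * g, k * e, k * d) \<noteq> (0, 0, 0)" using 4 by (cases "k = 0") auto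
    thus ?thesis using F k 4 F01 shift[of 1 k 0 0] dbl[of a]
      by (intro wit[of "1 + k * g" "k * e" "k * d"]) (auto intro!: cl)
  next
    case 5
    \<comment> \<open>The radical vector is now (g, 0, 0), so a shift of (1, 0, 0) could be zero; a
      shift of (0, 1, 0) keeps its second entry.\<close>
    obtain k where k: "k \<in> F" "k\<^sup>2 = b / f" using sqrt[OF cl(4)[OF F(2) fF]] by blast
    show ?thesis using F k 5 F01 shift[of 0 k 1 0] dbl[of b]
      by (intro wit[of "k * g" "1" 0]) (auto intro!: cl)
  qed
qed

text \<open>The case of one ternary quadratic form of the Chevalley-Warning theorem. Opposite
  entries are added because the matrix need not be symmetric.\<close>

lemma conic_has_point:
  assumes A: "mat_over q 1 (A :: 'a ^ 3 ^ 3)"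
  obtains v where "v \<in> vecs_over q 1" "v \<noteq> 0" "quad A v = 0"
proof -
  have el: "A $ i $ j \<in> subfld q 1" for i j using A by (simp add: mat_over_def)
  have "\<exists>x\<in>subfld q 1. \<exists>y\<in>subfld q 1. \<exists>z\<in>subfld q 1. (x, y, z) \<noteq> (0, 0, 0) \<and>
    A $ 1 $ 1 * x\<^sup>2 + A $ 2 $ 2 * y\<^sup>2 + A $ 3 $ 3 * z\<^sup>2 + (A $ 1 $ 2 + A $ 2 $ 1) * x * y
      + (A $ 1 $ 3 + A $ 3 $ 1) * x * z + (A $ 2 $ 3 + A $ 3 $ 2) * y * z = 0"
    by (cases "(2 :: 'a) = 0"; intro isotropic_char_2 isotropic_char_not_2 subfld_closed el)
  then obtain x y z where h: "x \<in> subfld q 1" "y \<in> subfld q 1" "z \<in> subfld q 1" "(x, y, z) \<noteq> (0, 0, 0)"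
    "A $ 1 $ 1 * x\<^sup>2 + A $ 2 $ 2 * y\<^sup>2 + A $ 3 $ 3 * z\<^sup>2 + (A $ 1 $ 2 + A $ 2 $ 1) * x * y
      + (A $ 1 $ 3 + A $ 3 $ 1) * x * z + (A $ 2 $ 3 + A $ 3 $ 2) * y * z = 0"
    by blast
  show ?thesis
  proof (rule that[of "vector [x, y, z]"])
    show "(vector [x, y, z] :: 'a ^ 3) \<in> vecs_over q 1"
      using h(1-3) unfolding vecs_over_def mem_Collect_eq forall_3 by (simp del: One_nat_def)
    show "vector [x, y, z] \<noteq> (0 :: 'a ^ 3)"
      using h(4) by (auto simp: vec_eq_iff forall_3)
    show "quad A (vector [x, y, z]) = 0"
      unfolding h(5)[symmetric] by (simp add: quad_def sum_3 power2_eq_square algebra_simps)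
  qed
qed

lemma std_conic_over: "mat_over q k (std_conic :: 'a ^ 3 ^ 3)"
  using subfld_unary(1)[OF subfld_01(2)[of k]] subfld_01[of k]
  unfolding mat_over_def std_conic_def by simp

text \<open>A rational point \<open>e\<close> of the conic extends to a hyperbolic pair
  \<open>e\<close>, \<open>w\<close>; a vector \<open>v\<close> orthogonal to both completes the
  basis, and only its value remains as a parameter, which becomes the factor
  \<open>c\<close>.\<close>

lemma conic_normal_form:
  assumes A: "mat_over q 1 (A :: 'a ^ 3 ^ 3)" and nd: "nondegenerate_on UNIV A"
  obtains T c where "mat_over q 1 T" "invertible T" "c \<noteq> 0" "\<And>x. quad A (T *v x) = c * quad std_conic x"
proof -
  obtain e where e: "e \<in> vecs_over q 1" "e \<noteq> 0" "quad A e = 0"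
    using conic_has_point[OF A] by blast
  have "\<exists>i. polar A e (axis i 1) \<noteq> 0"
  proof (rule ccontr)
    assume "\<nexists>i. polar A e (axis i 1) \<noteq> 0"
    hence "cart_basis \<subseteq> {y. polar A e y = 0}" by (auto simp: cart_basis_def)
    moreover have "vec.subspace {y. polar A e y = 0}"
      by (rule vec.subspaceI) (auto simp: polar_linear, simp add: polar_expand)
    ultimately have "vec.span cart_basis \<subseteq> {y. polar A e y = 0}" by (rule vec.span_minimal)
    moreover obtain y where "polar A e y \<noteq> 0"
      using nd e by (auto simp: nondegenerate_on_def)
    ultimately show False by auto
  qed
  then obtain i where i: "polar A e (axis i 1) \<noteq> 0" by blast
  define p where "p = polar A e (axis i 1)"
  \<comment> \<open>Adding a multiple c of \<open>e\<close> to the axis vector changes its value by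
    c p, so an isotropic vector is found by a linear equation, without halving; the outer factor
    makes the polar value 1.\<close>
  define w where "w = inverse p *s (axis i 1 - (quad A (axis i 1) / p) *s e)"
  have pF: "p \<in> subfld q 1" unfolding p_def by (intro polar_over A e axis_over)
  have wF: "w \<in> vecs_over q 1"
    unfolding w_def by (intro vecs_over_closed subfld_closed pF axis_over e quad_over A)
  have "quad A (axis i 1 + (- (quad A (axis i 1) / p)) *s e) = 0"
    unfolding quad_add quad_scale polar_linear(2) polar_linear(3)[of A "axis i 1"] p_def[symmetric]
    using i e(3) by (simp add: p_def)
  hence "quad A (axis i 1 - (quad A (axis i 1) / p) *s e) = 0" by simp
  hence w0: "quad A w = 0" unfolding w_def quad_scale by simp
  have ew: "polar A e w = 1"
    using i e(3) by (simp add: w_def polar_linear p_def)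
  obtain j where j: "vec.span {axis j 1, w, e} = UNIV"
    using nondegenerate_basis[OF e(2,3) w0 ew] by blast
  \<comment> \<open>The projection of the third basis vector to the orthogonal complement of the
    hyperbolic pair.\<close>
  define v where "v = axis j 1 - polar A w (axis j 1) *s e - polar A e (axis j 1) *s w"
  have vF: "v \<in> vecs_over q 1"
    unfolding v_def by (intro vecs_over_closed polar_over A axis_over e wF)
  have we: "polar A w e = 1" using ew by (simp add: polar_linear(3)[of A w])
  have ve: "polar A v e = 0"
    using e(3) ew by (simp add: polar_linear(3)[of A v] polar_linear v_def)
  have vw: "polar A v w = 0"
    using w0 we by (simp add: polar_linear(3)[of A v] polar_linear v_def)
  have ev: "polar A e v = 0" using ve by (simp add: polar_linear(3)[of A e])
  have v0: "v \<noteq> 0"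
  proof
    assume "v = 0"
    hence "axis j 1 = polar A w (axis j 1) *s e + polar A e (axis j 1) *s w"
      by (simp add: v_def algebra_simps)
    moreover have "polar A w (axis j 1) *s e + polar A e (axis j 1) *s w \<in> vec.span {w, e}"
      by (intro vec.span_add vec.span_scale vec.span_base) auto
    ultimately have "axis j 1 \<in> vec.span {w, e}" by simp
    hence "vec.span {w, e} = UNIV" using j by (simp add: vec.span_redundant)
    hence "vec.dim {w, e} = 3"
      using vec.dim_span[of "{w, e}"] vec_dim_card[where 'a = 'a and 'n = 3] by simp
    moreover have "vec.dim {w, e} \<le> card {w, e}" by (rule vec.dim_le_card') auto
    moreover have "card {w, e} \<le> 2" by (simp add: card_insert_if)
    ultimately show False by simp
  qed
  define d where "d = quad A v"
  \<comment> \<open>Otherwise \<open>v\<close> would be a singular point: it is orthogonal to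
    \<open>e\<close> and \<open>w\<close>, and its polar value with the third basis vector is 2
    d.\<close>
  have d0: "d \<noteq> 0"
  proof
    assume d: "d = 0"
    then obtain y where y: "polar A v y \<noteq> 0"
      using nd v0 by (auto simp: nondegenerate_on_def d_def)
    have "polar A v (axis j 1) = 0"
    proof -
      have "axis j 1 = v + polar A w (axis j 1) *s e + polar A e (axis j 1) *s w"
        by (simp add: v_def)
      thus ?thesis using d ve vw
        by (metis polar_linear(1,2,4) d_def mult_zero_right add.right_neutral)
    qed
    hence "{axis j 1, w, e} \<subseteq> {y. polar A v y = 0}" using ve vw by auto
    moreover have "vec.subspace {y. polar A v y = 0}"
      by (rule vec.subspaceI) (auto simp: polar_linear, simp add: polar_expand)
    ultimately have "vec.span {axis j 1, w, e} \<subseteq> {y. polar A v y = 0}" by (rule vec.span_minimal)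
    thus False using j y by auto
  qed
  have dF: "d \<in> subfld q 1" unfolding d_def by (intro quad_over A vF)
  \<comment> \<open>In the basis \<open>e\<close>, \<open>v\<close>, \<open>w\<close> the form is
    x_1 x_3 + d x_2^2; the factor -d in the first column turns it into -d times the standard
    one.\<close>
  define T :: "'a ^ 3 ^ 3" where "T = (\<chi> i k. if k = 1 then (- d) * e $ i else if k = 2 then v $ i else w $ i)"
  have Tx: "T *v x = (- d * x $ 1) *s e + (x $ 2 *s v + x $ 3 *s w)" for x
    by (simp add: vec_eq_iff matrix_vector_mult_def sum_3 T_def mult_ac)
  have form: "quad A (T *v x) = (- d) * quad std_conic x" for x
    unfolding Tx quad_add quad_scale polar_linear(1,2) polar_scale_left
    by (simp add: e w0 vw ev ew d_def[symmetric] quad_std_conic power2_eq_square algebra_simps)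
  have "x = 0" if "T *v x = 0" for x
  proof (rule ccontr)
    assume "x \<noteq> 0"
    have "quad std_conic x = 0" using form[of x] that d0 by (simp add: quad_def)
    then obtain y where y: "polar std_conic x y \<noteq> 0"
      using std_conic_nondegenerate \<open>x \<noteq> 0\<close> by blast
    have "polar A (T *v x) (T *v y) = (- d) * polar std_conic x y"
      unfolding polar_def matrix_vector_right_distrib[symmetric] form
      by (simp add: right_diff_distrib)
    moreover have "polar A 0 (T *v y) = 0" by (simp add: polar_expand)
    ultimately show False using y d0 that by simp
  qed
  hence "invertible T"
    by (simp add: invertible_left_inverse matrix_left_invertible_ker)
  moreover have "mat_over q 1 T"
    using e(1) vF wF dF unfolding mat_over_def T_def vecs_over_def
    by (auto intro!: subfld_closed)
  ultimately show ?thesis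
    using that[of T "- d"] form d0 by simp
qed

end

section \<open>Conics, subplanes and lines in coordinates\<close>

abbreviation matrix_image :: "'a::field ^ 'm ^ 'n \<Rightarrow> ('a ^ 'm) set set \<Rightarrow> ('a ^ 'n) set set" where
  "matrix_image A S \<equiv> (\<lambda>P. (*v) A ` P) ` S"

definition ldot :: "'a::field ^ 'n \<Rightarrow> 'a ^ 'n \<Rightarrow> 'a" where
  "ldot l x = (\<Sum>i\<in>UNIV. l $ i * x $ i)"

lemma ldot_linear:
  "ldot l (x + y) = ldot l x + ldot l y" "ldot l (x - y) = ldot l x - ldot l y"
  "ldot l (c *s x) = c * ldot l x" "ldot l 0 = 0"
  by (simp_all add: ldot_def sum.distrib sum_subtractf sum_distrib_left algebra_simps)

lemma ldot_nonzero:
  assumes "l \<noteq> 0"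
  obtains i where "ldot l (axis i 1) \<noteq> 0"
proof -
  obtain i where "l $ i \<noteq> 0" using assms by (auto simp: vec_eq_iff)
  moreover have "ldot l (axis i 1) = l $ i"
    by (simp add: ldot_def axis_def if_distrib[of "(*) _"] cong: if_cong)
  ultimately show ?thesis using that by metis
qed

lemma subspace_ldot: "vec.subspace {x. ldot l x = 0}"
  by (rule vec.subspaceI) (auto simp: ldot_linear)

lemma matrix_image_PG_iff:
  fixes A :: "'a::field ^ 'm ^ 'n"
  shows   "P \<in> matrix_image A (PG q k) \<longleftrightarrow> (\<exists>v. v \<in> vecs_over q k \<and> v \<noteq> 0 \<and> P = vec.span {A *v v})"
proof -
  have "PG q k = (\<lambda>v. vec.span {v}) ` {v :: 'a ^ 'm. v \<in> vecs_over q k \<and> v \<noteq> 0}"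
    by (auto simp: PG_def)
  hence "matrix_image A (PG q k) = (\<lambda>v. vec.span {A *v v}) ` {v. v \<in> vecs_over q k \<and> v \<noteq> 0}"
    by (simp add: image_image image_span_singleton)
  thus ?thesis by auto
qed

lemma matrix_image_quadric_iff:
  fixes A :: "'a::field ^ 'm ^ 'n"
  shows   "P \<in> matrix_image A (quadric_points q k G) \<longleftrightarrow>
    (\<exists>v. v \<in> vecs_over q k \<and> v \<noteq> 0 \<and> quad G v = 0 \<and> P = vec.span {A *v v})"
proof -
  have "quadric_points q k G =
      (\<lambda>v. vec.span {v}) ` {v :: 'a ^ 'm. v \<in> vecs_over q k \<and> v \<noteq> 0 \<and> quad G v = 0}"
    by (auto simp: quadric_points_iff)
  hence "matrix_image A (quadric_points q k G) =
      (\<lambda>v. vec.span {A *v v}) ` {v. v \<in> vecs_over q k \<and> v \<noteq> 0 \<and> quad G v = 0}"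
    by (simp add: image_image image_span_singleton)
  thus ?thesis by auto
qed

lemma matrix_image_compose: "matrix_image (A ** B) S = matrix_image A (matrix_image B S)"
  by (simp add: image_image matrix_vector_mul_assoc)

text \<open>Both sides contain the span of two independent vectors and have dimension at most
  2.\<close>

lemma line_eq_kernel:
  fixes A :: "'a::field ^ 3 ^ 3"
  assumes A: "invertible A" and W: "vec.subspace W" "vec.dim W = 2" and l: "l \<noteq> 0"
    and uv: "A *v u \<in> W" "A *v v \<in> W" "ldot l u = 0" "ldot l v = 0"
      "vec.span {A *v u} \<noteq> vec.span {A *v v}" "u \<noteq> 0" "v \<noteq> 0"
  shows "W = (*v) A ` {x. ldot l x = 0}"
proof -
  let ?K = "(*v) A ` {x. ldot l x = 0}"
  have nz: "A *v u \<noteq> 0" "A *v v \<noteq> 0"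
    using uv(6,7) invertible_inv_vec(2)[OF A, of u] invertible_inv_vec(2)[OF A, of v] by auto
  have "A *v u \<notin> vec.span {A *v v}"
  proof
    assume "A *v u \<in> vec.span {A *v v}"
    then obtain c where "A *v u = c *s (A *v v)" by (auto simp: vec.span_singleton)
    moreover have "c \<noteq> 0" using calculation nz by auto
    ultimately show False using uv(5) span_singleton_eq_iff[of "A *v u" "A *v v"] by blast
  qed
  hence d: "vec.dim (vec.span {A *v u, A *v v}) = 2"
    using nz by (simp add: vec.dim_insert)
  have sub: "vec.span {A *v u, A *v v} \<subseteq> W"
    using uv(1,2) by (intro vec.span_minimal W) auto
  have eqW: "vec.span {A *v u, A *v v} = W"
    by (rule vec.subspace_dim_equal[OF vec.subspace_span W(1) sub]) (use d W(2) in linarith)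
  have K: "vec.subspace ?K"
    by (rule vec.linear_subspace_image[OF matrix_vector_mul_linear_gen subspace_ldot])
  have "vec.dim ?K \<le> 2"
  proof -
    obtain i where i: "ldot l (axis i 1) \<noteq> 0" using ldot_nonzero[OF l] .
    have "A *v axis i 1 \<notin> ?K"
      using i invertible_inv_vec(2)[OF A] by (auto simp: image_iff) metis
    moreover have "vec.span ?K = ?K" using K vec.span_eq_iff by blast
    ultimately have "vec.span ?K \<subset> vec.span UNIV"
      by (metis UNIV_I psubsetI subset_UNIV vec.span_UNIV)
    hence "vec.dim ?K < vec.dim (UNIV :: ('a ^ 3) set)" by (rule vec.dim_psubset)
    thus ?thesis by (simp only: vec_dim_card) simp
  qed
  moreover have sub: "vec.span {A *v u, A *v v} \<subseteq> ?K"
    using uv(3,4) by (intro vec.span_minimal K) auto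
  ultimately have "vec.span {A *v u, A *v v} = ?K"
    using d by (intro vec.subspace_dim_equal[OF vec.subspace_span K sub]) linarith
  thus ?thesis using eqW by simp
qed

context tower
begin

lemma pow_surj: "qpow n \<Longrightarrow> \<exists>y :: 'a. y ^ n = x"
proof -
  assume n: "qpow n"
  have "surj (\<lambda>y :: 'a. y ^ n)"
    by (rule finite_UNIV_inj_surj) (simp_all add: inj_def inj_pow[OF n])
  thus ?thesis by (metis surjD)
qed

lemma frob_image_span: "qpow n \<Longrightarrow> frob n ` vec.span {v :: 'a ^ 'n} = vec.span {frob n v}"
  unfolding vec.span_singleton image_image frob_scale
  using pow_surj[of n] by (auto simp: image_iff) metis

lemma matrix_image_PG:
  assumes "mat_over q k (T :: 'a ^ 'n ^ 'n)" "invertible T"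
  shows "matrix_image T (PG q k) = PG q k"
proof (intro set_eqI iffI)
  fix P :: "('a ^ 'n) set" assume "P \<in> matrix_image T (PG q k)"
  then obtain v where v: "v \<in> vecs_over q k" "v \<noteq> 0" "P = vec.span {T *v v}"
    by (auto simp: PG_def image_span_singleton)
  moreover have "T *v v \<noteq> 0" using v invertible_inv_vec(2)[OF assms(2), of v] by auto
  ultimately show "P \<in> PG q k" using mat_over_mult_vec[OF assms(1) v(1)] by (auto simp: PG_def)
next
  fix P :: "('a ^ 'n) set" assume "P \<in> PG q k"
  then obtain v where v: "v \<in> vecs_over q k" "v \<noteq> 0" "P = vec.span {v}" by (auto simp: PG_def)
  let ?w = "matrix_inv T *v v"
  have w: "T *v ?w = v" by (rule invertible_inv_vec[OF assms(2)])
  have "?w \<in> vecs_over q k" using assms v by (intro mat_over_mult_vec mat_over_inv)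
  moreover have "?w \<noteq> 0" using w v by auto
  ultimately have "vec.span {?w} \<in> PG q k" by (auto simp: PG_def)
  moreover have "P = (*v) T ` vec.span {?w}" by (simp add: image_span_singleton w v)
  ultimately show "P \<in> matrix_image T (PG q k)" by blast
qed

lemma matrix_image_quadric:
  assumes T: "mat_over q k (T :: 'a ^ 'n ^ 'n)" "invertible T"
    and c: "c \<noteq> 0" "\<And>x. quad G (T *v x) = c * quad H x"
  shows "matrix_image T (quadric_points q k H) = quadric_points q k G"
proof (intro set_eqI iffI)
  fix P :: "('a ^ 'n) set" assume "P \<in> matrix_image T (quadric_points q k H)"
  then obtain v where v: "v \<in> vecs_over q k" "v \<noteq> 0" "quad H v = 0" "P = vec.span {T *v v}"
    by (auto simp: quadric_points_iff image_span_singleton)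
  moreover have "T *v v \<noteq> 0" using v invertible_inv_vec(2)[OF assms(2), of v] by auto
  ultimately show "P \<in> quadric_points q k G"
    using mat_over_mult_vec[OF T(1) v(1)] c(2)[of v] by (auto simp: quadric_points_iff)
next
  fix P :: "('a ^ 'n) set" assume "P \<in> quadric_points q k G"
  then obtain v where v: "v \<in> vecs_over q k" "v \<noteq> 0" "quad G v = 0" "P = vec.span {v}"
    by (auto simp: quadric_points_iff)
  let ?w = "matrix_inv T *v v"
  have w: "T *v ?w = v" by (rule invertible_inv_vec[OF assms(2)])
  have "?w \<in> vecs_over q k" using assms v by (intro mat_over_mult_vec mat_over_inv)
  moreover have "?w \<noteq> 0" using w v by auto
  moreover have "quad H ?w = 0" using c(2)[of ?w] c(1) v w by simp
  ultimately have "vec.span {?w} \<in> quadric_points q k H" by (auto simp: quadric_points_iff)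
  moreover have "P = (*v) T ` vec.span {?w}" by (simp add: image_span_singleton w v)
  ultimately show "P \<in> matrix_image T (quadric_points q k H)" by blast
qed

text \<open>The normalising matrix has entries in the field of order q, so it permutes PG(2, q), and
  composing with it changes the conic upstairs but not the image subplane.\<close>

lemma Fq_conic_frame:
  assumes "Fq_conic_in q \<pi> (C :: ('a ^ 3) set set)"
  obtains A where "mat_over q 3 A" "invertible A" "\<pi> = matrix_image A (PG q 1)"
    "C = matrix_image A (quadric_points q 1 std_conic)"
proof -
  obtain A N where A: "mat_over q 3 A" "invertible A" "\<pi> = matrix_image A (PG q 1)"
      "nondeg_conic q 1 N" "C = matrix_image A N"
    using assms unfolding Fq_conic_in_def by blast
  then obtain G where G: "mat_over q 1 G" "nondegenerate_on UNIV G" "N = quadric_points q 1 G"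
    unfolding nondeg_conic_def by blast
  obtain T c where T: "mat_over q 1 T" "invertible T" "c \<noteq> 0" "\<And>x. quad G (T *v x) = c * quad std_conic x"
    by (rule conic_normal_form[OF G(1,2)], rule that, assumption+)
  show ?thesis
  proof (rule that[of "A ** T"])
    show "mat_over q 3 (A ** T)" by (rule mat_over_mult[OF A(1) mat_over_1_imp[OF T(1)]])
    show "invertible (A ** T)" by (intro invertible_mult A T)
    show "\<pi> = matrix_image (A ** T) (PG q 1)"
      unfolding matrix_image_compose matrix_image_PG[OF T(1,2)] by (rule A)
    show "C = matrix_image (A ** T) (quadric_points q 1 std_conic)"
      unfolding matrix_image_compose matrix_image_quadric[OF T] A(5) G(3) ..
  qed
qed

text \<open>
  On the points \<open>(1, t, t\<^sup>2)\<close> of the conic over the field of order \<open>q\<close> a quadratic form is a polynomial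
  of degree at most 4 in \<open>t\<close>, so it vanishes identically if it vanishes on all of them.
\<close>

lemma conic_ext_eq:
  assumes q: "q \<ge> 5" and A: "mat_over q k A" "invertible (A :: 'a ^ 3 ^ 3)"
    and D: "matrix_image A (quadric_points q 1 std_conic) \<subseteq> D"
      "D \<subseteq> matrix_image A (quadric_points q k std_conic)"
  shows "conic_ext q k D = matrix_image A (quadric_points q k std_conic)"
  unfolding conic_ext_def
proof (rule the_equality, rule conjI)
  let ?I = "matrix_inv A"
  define G where "G = transpose ?I ** std_conic ** ?I"
  have G: "quad G x = quad std_conic (?I *v x)" "polar G x y = polar std_conic (?I *v x) (?I *v y)" for x y
    by (simp_all add: G_def quad_compose polar_compose)
  have "mat_over q k G"
    unfolding G_def by (intro mat_over_mult mat_over_transpose mat_over_inv A std_conic_over)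
  moreover have "nondegenerate_on UNIV G"
    unfolding nondegenerate_on_def
  proof (intro ballI impI, elim conjE)
    fix x assume x: "x \<noteq> 0" "quad G x = 0"
    have "?I *v x \<noteq> 0" using x invertible_inv_vec(1)[OF A(2), of x] by auto
    then obtain y where "polar std_conic (?I *v x) y \<noteq> 0"
      using std_conic_nondegenerate[of "?I *v x"] x(2) G by metis
    thus "\<exists>y\<in>UNIV. polar G x y \<noteq> 0"
      by (intro bexI[of _ "A *v y"]) (simp_all add: G invertible_inv_vec[OF A(2)])
  qed
  moreover have "matrix_image A (quadric_points q k std_conic) = quadric_points q k G"
    by (rule matrix_image_quadric[OF A, of 1]) (simp_all add: G invertible_inv_vec[OF A(2)])
  ultimately show "nondeg_conic q k (matrix_image A (quadric_points q k std_conic))"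
    unfolding nondeg_conic_def by blast
  show "D \<subseteq> matrix_image A (quadric_points q k std_conic)" by (rule D)
next
  \<comment> \<open>Only the points over order q, which \<open>D\<close> contains, are used to
    identify \<open>D'\<close>. Hence the argument serves both the extension to order q^3 and the
    one from there to order q^6.\<close>
  fix D' assume D': "nondeg_conic q k D' \<and> D \<subseteq> D'"
  then obtain G where G: "nondegenerate_on UNIV G" "D' = quadric_points q k G"
    unfolding nondeg_conic_def by blast
  define H where "H = transpose A ** G ** A"
  have H: "quad H x = quad G (A *v x)" "polar H x y = polar G (A *v x) (A *v y)" for x y
    by (simp_all add: H_def quad_compose polar_compose)
  \<comment> \<open>The monomials x_2^2 and x_1 x_3 both become t^2 and share a coefficient; this is
    the only freedom that the vanishing of \<open>p\<close> leaves to the form.\<close>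
  define p where "p = [:H $ 1 $ 1, H $ 1 $ 2 + H $ 2 $ 1, H $ 2 $ 2 + (H $ 1 $ 3 + H $ 3 $ 1),
    H $ 2 $ 3 + H $ 3 $ 2, H $ 3 $ 3:]"
  have "poly p t = 0" if t: "t \<in> subfld q 1" for t
  proof -
    let ?v = "vector [1, t, t\<^sup>2] :: 'a ^ 3"
    have "?v \<in> vecs_over q 1"
      using t subfld_closed(7)[OF t, of 2] subfld_01(2)[of 1] unfolding vecs_over_def mem_Collect_eq forall_3 by (simp del: One_nat_def)
    moreover have "?v \<noteq> 0" by (simp add: vec_eq_iff forall_3)
    moreover have "quad std_conic ?v = 0" by (simp add: quad_std_conic)
    ultimately have "vec.span {?v} \<in> quadric_points q 1 std_conic"
      unfolding quadric_points_iff by blast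
    hence "(*v) A ` vec.span {?v} \<in> quadric_points q k G" using D D' G by blast
    hence "quad G (A *v ?v) = 0"
      unfolding image_span_singleton quadric_points_def by (auto intro: vec.span_base)
    hence "quad H ?v = 0" by (simp only: H)
    thus ?thesis
      by (simp add: p_def quad_def sum_3 power2_eq_square algebra_simps)
  qed
  hence "subfld q 1 \<subseteq> {t. poly p t = 0}" by blast
  hence "q \<le> card {t. poly p t = 0}"
    using card_mono[of "{t. poly p t = 0}" "subfld q 1"] card_subfld[of 1] by simp
  moreover have "degree p \<le> 4" by (simp add: p_def)
  ultimately have "p = 0"
    using card_poly_roots_bound[of p] q by linarith
  hence z: "H $ 1 $ 1 = 0" "H $ 1 $ 2 + H $ 2 $ 1 = 0" "H $ 2 $ 2 = - (H $ 1 $ 3 + H $ 3 $ 1)"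
    "H $ 2 $ 3 + H $ 3 $ 2 = 0" "H $ 3 $ 3 = 0"
    by (simp_all only: eq_neg_iff_add_eq_0) (simp_all add: p_def)
  define c where "c = H $ 1 $ 3 + H $ 3 $ 1"
  have c: "quad G (A *v x) = c * quad std_conic x" for x
  proof -
    have "quad H x = H $ 1 $ 1 * (x $ 1)\<^sup>2 + (H $ 1 $ 2 + H $ 2 $ 1) * x $ 1 * x $ 2 + H $ 2 $ 2 * (x $ 2)\<^sup>2
      + c * x $ 1 * x $ 3 + (H $ 2 $ 3 + H $ 3 $ 2) * x $ 2 * x $ 3 + H $ 3 $ 3 * (x $ 3)\<^sup>2"
      by (simp add: quad_def sum_3 power2_eq_square c_def algebra_simps)
    thus ?thesis unfolding z c_def[symmetric] H quad_std_conic by (simp add: algebra_simps)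
  qed
  have "c \<noteq> 0"
  proof
    assume "c = 0"
    hence q0: "quad G x = 0" for x
      using c[of "matrix_inv A *v x"] by (simp add: invertible_inv_vec[OF A(2)])
    hence "polar G x y = 0" for x y by (simp add: polar_def)
    thus False using G(1) q0 unfolding nondegenerate_on_def
      by (metis UNIV_I axis_eq_0_iff one_neq_zero)
  qed
  thus "D' = matrix_image A (quadric_points q k std_conic)"
    unfolding G(2) using matrix_image_quadric[OF A _ c] by simp
qed

text \<open>Pulled back along \<open>A\<close>, the collineation is Frobenius followed by a matrix
  \<open>D\<close>. As it fixes every point of PG(2, q), each vector over order q is an eigenvector
  of \<open>D\<close>, and so \<open>D\<close> is scalar.\<close>

lemma conjugacy_frame:
  assumes B: "conjugacy_matrix q \<pi> B" and A: "invertible (A :: 'a ^ 3 ^ 3)"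
    and \<pi>: "\<pi> = matrix_image A (PG q 1)"
  obtains c where "c \<noteq> 0" "\<And>x. B *v frob q (A *v x) = c *s (A *v frob q x)"
proof -
  define D where "D = matrix_inv A ** B ** fmat q A"
  have D: "A *v (D *v frob q x) = B *v frob q (A *v x)" for x
    by (simp add: D_def frob_mult_vec matrix_vector_mul_assoc[symmetric] invertible_inv_vec[OF A])
  have eig: "\<exists>k. D *v v = k *s v" if v: "v \<in> vecs_over q 1" "v \<noteq> 0" for v
  proof -
    have "vec.span {v} \<in> PG q 1" using v by (auto simp: PG_def)
    hence "conj_map q B (vec.span {A *v v}) = vec.span {A *v v}"
      using B unfolding conjugacy_matrix_def \<pi> by (metis image_eqI image_span_singleton)
    hence "B *v frob q (A *v v) \<in> vec.span {A *v v}"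
      unfolding conj_map_def by (metis (no_types, lifting) imageI insertI1 vec.span_base)
    then obtain k where "B *v frob q (A *v v) = A *v (k *s v)"
      by (auto simp: vec.span_singleton vector_scalar_mult_commute)
    moreover have "frob q v = v" using v vecs_over_iff[of v 1] by simp
    ultimately have "A *v (D *v v) = A *v (k *s v)" using D[of v] by simp
    thus ?thesis by (metis invertible_inv_vec(2)[OF A])
  qed
  \<comment> \<open>The vector \<open>1\<close> has all entries 1. Being an eigenvector too, it
    forces the eigenvalues of the three axis vectors to agree.\<close>
  obtain c where c: "D *v 1 = c *s 1"
    using eig[of 1] by (auto simp: vecs_over_def)
  have ax: "D *v axis i 1 = c *s axis i 1" for i
  proof -
    have "\<exists>k. D *v axis j 1 = k *s axis j 1" for j
      by (rule eig[OF axis_over]) simp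
    then obtain k where k: "\<And>j. D *v axis j 1 = k j *s axis j 1" by metis
    have "D $ j $ i = k i * axis i 1 $ j" for i j
      using arg_cong[OF k[of i], of "\<lambda>v. v $ j"]
      by (simp add: matrix_vector_mult_def) (simp add: axis_def if_distrib[of "(*) _"] cong: if_cong)
    moreover have "(\<Sum>j\<in>UNIV. D $ i $ j) = c"
      using arg_cong[OF c, of "\<lambda>v. v $ i"] by (simp add: matrix_vector_mult_def)
    ultimately have "k i = c" by (simp add: axis_def if_distrib[of "(*) _"] cong: if_cong)
    thus ?thesis using k by simp
  qed
  have Dx: "D *v x = c *s x" for x
  proof -
    have "vec.subspace {x. D *v x = c *s x}"
      by (rule vec.subspaceI)
        (auto simp: matrix_vector_right_distrib vector_scalar_mult_commute vector_add_ldistrib mult.commute)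
    moreover have "cart_basis \<subseteq> {x. D *v x = c *s x}" using ax by (auto simp: cart_basis_def)
    ultimately have "vec.span cart_basis \<subseteq> {x. D *v x = c *s x}" by (intro vec.span_minimal)
    thus ?thesis by auto
  qed
  show ?thesis
  proof (rule that[of c])
    show "B *v frob q (A *v x) = c *s (A *v frob q x)" for x
      by (simp add: D[symmetric] Dx vector_scalar_mult_commute)
    show "c \<noteq> 0"
    proof
      assume "c = 0"
      hence "B *v frob q (A *v axis 1 1) = 0" by (simp add: D[symmetric] Dx)
      moreover have "invertible B" using B by (simp add: conjugacy_matrix_def)
      ultimately have "frob q (A *v axis 1 1) = frob q 0"
        using invertible_inv_vec(2)[of B "frob q (A *v axis 1 1)"] by (simp add: frob_0)
      hence "A *v axis 1 1 = 0" by (simp add: frob_eq_iff)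
      thus False using invertible_inv_vec(2)[OF A, of "axis 1 1"] by simp
    qed
  qed
qed

lemma conj_map_frame:
  assumes c: "c \<noteq> 0" "\<And>x. B *v frob q (A *v x) = c *s (A *v frob q x)"
  shows "(conj_map q B ^^ n) (vec.span {A *v x}) = vec.span {(A :: 'a ^ 3 ^ 3) *v frob (q ^ n) x}"
proof (induction n)
  case 0
  show ?case by (simp add: frob_def)
next
  case (Suc n)
  let ?y = "frob (q ^ n) x"
  have "conj_map q B (vec.span {A *v ?y}) = (*v) B ` frob q ` vec.span {A *v ?y}"
    by (simp add: conj_map_def image_image)
  also have "\<dots> = vec.span {c *s (A *v frob q ?y)}"
    by (simp add: frob_image_span image_span_singleton c)
  also have "\<dots> = vec.span {A *v frob q ?y}"
    using c(1) span_singleton_eq_iff by blast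
  finally show ?case using Suc by (simp add: frob_frob mult.commute)
qed

text \<open>The cross product of two vectors over order q that represent points of the line is an
  equation of the line over order q; it vanishes only if the two points coincide.\<close>

lemma secant_line_kernel:
  assumes A: "invertible (A :: 'a ^ 3 ^ 3)" and W: "proj_subspace q 3 1 W"
    and sec: "card (points q 3 W \<inter> matrix_image A (PG q 1)) \<ge> 2"
  obtains l where "l \<in> vecs_over q 1" "l \<noteq> 0" "W = (*v) A ` {x. ldot l x = 0}"
proof -
  have sW: "vec.subspace W" "vec.dim W = 2" using W by (auto simp: proj_subspace_def)
  obtain P P' where P: "P \<noteq> P'" "P \<in> points q 3 W \<inter> matrix_image A (PG q 1)"
    "P' \<in> points q 3 W \<inter> matrix_image A (PG q 1)"
    using sec by (metis card_le_Suc0_iff_eq card.infinite not_less_eq_eq numeral_2_eq_2 zero_le zero_less_Suc not_le)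
  then obtain u v where u: "u \<in> vecs_over q 1" "u \<noteq> 0" "P = vec.span {A *v u}"
    and v: "v \<in> vecs_over q 1" "v \<noteq> 0" "P' = vec.span {A *v v}"
    using IntD2[OF P(2)] IntD2[OF P(3)] unfolding matrix_image_PG_iff by metis
  have in_W: "A *v u \<in> W" "A *v v \<in> W"
    using P(2,3) vec.span_base[of "A *v u" "{A *v u}"] vec.span_base[of "A *v v" "{A *v v}"]
    unfolding u(3) v(3) points_def by blast+
  define l where "l = (vector [u $ 2 * v $ 3 - u $ 3 * v $ 2, u $ 3 * v $ 1 - u $ 1 * v $ 3,
    u $ 1 * v $ 2 - u $ 2 * v $ 1] :: 'a ^ 3)"
  have lF: "l \<in> vecs_over q 1"
    using u(1) v(1) unfolding vecs_over_def mem_Collect_eq forall_3 l_def vector_3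
    by (intro conjI subfld_closed) auto
  have l0: "l \<noteq> 0"
  proof
    assume "l = 0"
    hence e: "u $ 2 * v $ 3 = u $ 3 * v $ 2" "u $ 3 * v $ 1 = u $ 1 * v $ 3" "u $ 1 * v $ 2 = u $ 2 * v $ 1"
      unfolding vec_eq_iff forall_3 l_def by auto
    hence e': "u $ i * v $ j = u $ j * v $ i" for i j
      using exhaust_3[of i] exhaust_3[of j] by auto
    obtain k where k: "v $ k \<noteq> 0" using v(2) by (auto simp: vec_eq_iff)
    have uv: "u = (u $ k / v $ k) *s v"
      using k e'[of _ k] by (simp add: vec_eq_iff field_simps)
    hence "u $ k / v $ k \<noteq> 0" using u(2) by auto
    moreover have "A *v u = (u $ k / v $ k) *s (A *v v)"
      by (subst uv) (rule vector_scalar_mult_commute)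
    ultimately have "P = P'" unfolding u v span_singleton_eq_iff by blast
    with P show False by blast
  qed
  have "ldot l u = 0" "ldot l v = 0"
    by (simp_all add: ldot_def sum_3 l_def algebra_simps)
  hence "W = (*v) A ` {x. ldot l x = 0}"
    using line_eq_kernel[OF A sW l0 in_W] P(1) u v by blast
  thus ?thesis using that lF l0 by blast
qed

text \<open>On (1, t, t^2) the equation of the line is a quadratic in t, with (0, 0, 1) as the value
  at infinity. A tangent is included, with \<open>y\<close> and \<open>z\<close> the same point. As
  \<open>z\<close> is nonzero, the last implication says that conjugate \<open>y\<close> and
  \<open>z\<close> are different points.\<close>

lemma line_conic_points:
  assumes l: "(l :: 'a ^ 3) \<in> vecs_over q 1" "l \<noteq> 0"
  obtains y z where "y \<noteq> 0" "z \<noteq> 0" "quad std_conic y = 0" "quad std_conic z = 0"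
    "ldot l y = 0" "ldot l z = 0"
    "\<And>x. quad std_conic x = 0 \<Longrightarrow> ldot l x = 0 \<Longrightarrow> \<exists>c. x = c *s y \<or> x = c *s z"
    "y \<in> vecs_over q 1 \<and> z \<in> vecs_over q 1 \<or> z = frob q y \<and> y = frob q z \<and> (\<forall>c. c *s y = z \<longrightarrow> c = 0)"
proof -
  define p where "p = (\<lambda>t. vector [1, t, t\<^sup>2] :: 'a ^ 3)"
  define o' where "o' = (vector [0, 0, 1] :: 'a ^ 3)"
  have lF: "l $ i \<in> subfld q 1" for i using l by (simp add: vecs_over_def)
  have p0: "p t \<noteq> 0" "quad std_conic (p t) = 0" "ldot l (p t) = l $ 1 + l $ 2 * t + l $ 3 * t\<^sup>2" for t
    by (simp_all add: p_def vec_eq_iff forall_3 quad_std_conic ldot_def sum_3)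
  have o0: "o' \<noteq> 0" "quad std_conic o' = 0" "ldot l o' = l $ 3"
    by (simp_all add: o'_def vec_eq_iff forall_3 quad_std_conic ldot_def sum_3)
  have pF: "p t \<in> vecs_over q 1" if "t \<in> subfld q 1" for t
    using that subfld_closed(7)[OF that, of 2] subfld_01(2)[of 1]
    unfolding vecs_over_def mem_Collect_eq forall_3 p_def by (simp del: One_nat_def)
  have oF: "o' \<in> vecs_over q 1"
    using subfld_01[of 1] unfolding vecs_over_def mem_Collect_eq forall_3 o'_def by (simp del: One_nat_def)
  have pts: "(\<exists>c t. c \<noteq> 0 \<and> x = c *s p t) \<or> (\<exists>c. x = c *s o')" if "quad std_conic x = 0" for x
    using std_conic_points[OF that] unfolding p_def o'_def
    by (metis vec_eq_iff vector_3(1) vector_smult_component mult_zero_left)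
  consider "l $ 3 = 0" "l $ 2 = 0" | "l $ 3 = 0" "l $ 2 \<noteq> 0" | "l $ 3 \<noteq> 0" by blast
  thus ?thesis
  proof cases
    \<comment> \<open>The line x_1 = 0 is the tangent at (0, 0, 1), which is taken twice.\<close>
    case 1
    hence "l $ 1 \<noteq> 0" using l by (auto simp: vec_eq_iff forall_3)
    hence nz: "ldot l (c *s p t) = 0 \<Longrightarrow> c = 0" for c t using 1 by (simp add: ldot_linear p0)
    have o: "ldot l o' = 0" using 1 by (simp add: o0)
    have all: "\<exists>c. x = c *s o'" if "quad std_conic x = 0" "ldot l x = 0" for x
      using pts[OF that(1)] that(2) nz by blast
    show ?thesis
      by (rule that[OF o0(1) o0(1) o0(2) o0(2) o o]) (use all oF in blast)+
  next
    case 2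
    define t where "t = - l $ 1 / l $ 2"
    have tF: "t \<in> subfld q 1" unfolding t_def by (intro subfld_closed lF)
    have t: "ldot l (p t) = 0" using 2 by (simp add: p0 t_def)
    have o: "ldot l o' = 0" using 2 by (simp add: o0)
    have st: "s = t" if "c \<noteq> 0" "ldot l (c *s p s) = 0" for c s
    proof -
      have "l $ 1 + l $ 2 * s = 0" using that 2 by (simp add: ldot_linear p0)
      hence "l $ 2 * s = - l $ 1" by (metis add_eq_0_iff)
      thus ?thesis using 2 by (simp add: t_def field_simps)
    qed
    have all: "\<exists>c. x = c *s p t \<or> x = c *s o'" if "quad std_conic x = 0" "ldot l x = 0" for x
      using pts[OF that(1)] that(2) st by blast
    show ?thesis
      by (rule that[OF p0(1) o0(1) p0(2) o0(2) t o]) (use all oF pF[OF tF] in blast)+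
  next
    case 3
    obtain r r' where r: "\<And>t. t\<^sup>2 + (l $ 2 / l $ 3) * t + l $ 1 / l $ 3 = (t - r) * (t - r')"
      and F: "r \<in> subfld q 1 \<and> r' \<in> subfld q 1 \<or> r' = r ^ q \<and> r = r' ^ q \<and> r \<noteq> r'"
      using quadratic_splits[OF subfld_closed(4)[OF lF lF] subfld_closed(4)[OF lF lF]] by blast
    have lp: "ldot l (p t) = l $ 3 * ((t - r) * (t - r'))" for t
      unfolding r[symmetric] p0 using 3 by (simp add: field_simps)
    have all: "\<exists>c. x = c *s p r \<or> x = c *s p r'" if x: "quad std_conic x = 0" "ldot l x = 0" for x
    proof -
      consider c t where "c \<noteq> 0" "x = c *s p t" | c where "x = c *s o'" using pts[OF x(1)] by blast
      thus ?thesis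
      proof cases
        case 1
        hence "t = r \<or> t = r'" using x(2) 3 by (auto simp: ldot_linear lp)
        thus ?thesis using 1 by blast
      next
        case 2
        hence "x = 0 *s p r" using x(2) 3 by (simp add: ldot_linear o0)
        thus ?thesis by blast
      qed
    qed
    have fp: "frob q (p t) = p (t ^ q)" for t
      using q_gt_1 by (simp add: vec_eq_iff forall_3 frob_def p_def power_mult[symmetric] mult.commute)
    have sc: "c *s p r = p r' \<Longrightarrow> r = r'" for c
      by (auto simp: vec_eq_iff forall_3 p_def)
    have "p r \<in> vecs_over q 1 \<and> p r' \<in> vecs_over q 1
      \<or> p r' = frob q (p r) \<and> p r = frob q (p r') \<and> (\<forall>c. c *s p r = p r' \<longrightarrow> c = 0)"
      using F pF sc fp by metis
    moreover have "ldot l (p r) = 0" "ldot l (p r') = 0" by (simp_all add: lp)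
    ultimately show ?thesis
      using that[OF p0(1) p0(1) p0(2) p0(2) _ _ all] by blast
  qed
qed

end

section \<open>Coordinates of the Bose representation\<close>

lemma fmat_fmat: "fmat m (fmat n A) = fmat (n * m) A"
  by (simp add: fmat_def frob_def vec_eq_iff power_mult)

lemma span_three: "vec.span (vec.span {a} \<union> vec.span {b} \<union> vec.span {c}) = {s *s a + t *s b + u *s c | s t u. True}"
  for a b c :: "'a::field ^ 'n"
proof -
  have "vec.span (vec.span {a} \<union> vec.span {b} \<union> vec.span {c})
    = {x + y |x y. x \<in> {x + y |x y. x \<in> vec.span {a} \<and> y \<in> vec.span {b}} \<and> y \<in> vec.span {c}}"
    by (simp only: vec.span_Un vec.span_span)
  also have "\<dots> = {s *s a + t *s b + u *s c | s t u. True}"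
    unfolding vec.span_singleton by (auto, blast)
  finally show ?thesis .
qed

context tower
begin

lemma frob_surj: "qpow n \<Longrightarrow> \<exists>u :: 'a ^ 'n. frob n u = v"
proof -
  assume n: "qpow n"
  obtain g where g: "\<And>x :: 'a. g x ^ n = x" using pow_surj[OF n] by metis
  have "frob n (\<chi> i. g (v $ i)) = v" by (simp add: frob_def vec_eq_iff g)
  thus ?thesis by blast
qed

lemma ldot_frob:
  assumes "l \<in> vecs_over q 1"
  shows "ldot l (frob q x) = (ldot l (x :: 'a ^ 'n)) ^ q"
proof -
  have "l $ i ^ q = l $ i" for i using assms subfld_1_iff by (auto simp: vecs_over_def simp del: One_nat_def)
  thus ?thesis by (simp add: ldot_def frob_def sum_pow power_mult_distrib)
qed

end

locale bose = tower q ty for q :: nat and ty :: "'a::{field,finite} itself" +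
  fixes H :: "'a ^ 3 ^ 9"
  assumes H_over: "mat_over q 3 H"
    and H_span: "vec.span (range ((*v) H) \<union> frob q ` range ((*v) H) \<union> frob (q\<^sup>2) ` range ((*v) H)) = UNIV"
begin

definition emb :: "'a ^ 3 \<Rightarrow> 'a ^ 3 \<Rightarrow> 'a ^ 3 \<Rightarrow> 'a ^ 9" where
  "emb a b c = H *v a + fmat q H *v b + fmat (q\<^sup>2) H *v c"

lemma emb_linear:
  "emb (a + a') (b + b') (c + c') = emb a b c + emb a' b' c'"
  "emb (a - a') (b - b') (c - c') = emb a b c - emb a' b' c'"
  "k *s emb a b c = emb (k *s a) (k *s b) (k *s c)"
  "emb 0 0 0 = 0"
  by (simp_all add: emb_def matrix_vector_right_distrib matrix_vector_mult_diff_distrib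
      vector_scalar_mult_commute vector_add_ldistrib)

lemma frob_H: "frob q (H *v a) = fmat q H *v frob q a" "frob (q\<^sup>2) (H *v a) = fmat (q\<^sup>2) H *v frob (q\<^sup>2) a"
  by (simp_all add: frob_mult_vec)

lemma emb_surj: "\<exists>a b c. v = emb a b c"
proof -
  let ?R = "{emb a b c | a b c. True}"
  have "vec.subspace ?R"
    by (rule vec.subspaceI) (use emb_linear(4) in force, auto simp: emb_linear(1)[symmetric] emb_linear(3), blast+)
  moreover have "range ((*v) H) \<union> frob q ` range ((*v) H) \<union> frob (q\<^sup>2) ` range ((*v) H) \<subseteq> ?R"
  proof -
    have "H *v a = emb a 0 0" "frob q (H *v a) = emb 0 (frob q a) 0"
        "frob (q\<^sup>2) (H *v a) = emb 0 0 (frob (q\<^sup>2) a)" for a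
      by (simp_all add: emb_def frob_H)
    hence "H *v a \<in> ?R" "frob q (H *v a) \<in> ?R" "frob (q\<^sup>2) (H *v a) \<in> ?R" for a by blast+
    thus ?thesis by blast
  qed
  ultimately have "UNIV \<subseteq> ?R" unfolding H_span[symmetric] by (intro vec.span_minimal)
  thus ?thesis by blast
qed

text \<open>A surjection between finite sets of the same size is injective.\<close>

lemma emb_eq_iff: "emb a b c = emb a' b' c' \<longleftrightarrow> a = a' \<and> b = b' \<and> c = c'"
proof -
  let ?f = "\<lambda>(a, b, c). emb a b c"
  have "surj ?f" using emb_surj by (auto simp: surj_def)
  hence "card (range ?f) = CARD('a ^ 9)" by simp
  also have "\<dots> = CARD(('a ^ 3) \<times> ('a ^ 3) \<times> ('a ^ 3))"
    by (simp add: power_add[symmetric])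
  finally have "inj ?f" by (intro eq_card_imp_inj_on) simp_all
  thus ?thesis by (auto simp: inj_def)
qed

text \<open>Since \<open>H\<close> is defined over order q^3, Frobenius permutes the three blocks
  cyclically; rationality of a vector can thus be read off from its coordinates.\<close>

lemma frob_emb: "frob q (emb a b c) = emb (frob q c) (frob q a) (frob q b)"
proof -
  have "fmat q (fmat (q\<^sup>2) H) = H"
    using H_over by (simp add: fmat_fmat mat_over_iff power3_eq_cube power2_eq_square)
  moreover have "fmat q (fmat q H) = fmat (q\<^sup>2) H"
    by (simp add: fmat_fmat power2_eq_square)
  ultimately show ?thesis
    by (simp add: emb_def frob_add frob_mult_vec add_ac)
qed

lemma frob3: "frob (q ^ 3) v = frob q (frob q (frob q (v :: 'a ^ 'n)))"
  by (simp add: frob_frob power3_eq_cube)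

lemma emb_over_1: "emb a b c \<in> vecs_over q 1 \<longleftrightarrow> a = frob q c \<and> b = frob q a \<and> c = frob q b"
  using vecs_over_iff[of "emb a b c" 1] by (auto simp: frob_emb emb_eq_iff)

lemma emb_over_3:
  "emb a b c \<in> vecs_over q 3 \<longleftrightarrow> a \<in> vecs_over q 3 \<and> b \<in> vecs_over q 3 \<and> c \<in> vecs_over q 3"
  by (auto simp: vecs_over_iff frob3 frob_emb emb_eq_iff)

definition scroll :: "'a ^ 3 \<Rightarrow> ('a ^ 9) set" where
  "scroll x = {emb (s *s x) (t *s x) (u *s x) | s t u. True}"

definition bose_line :: "'a ^ 3 \<Rightarrow> ('a ^ 9) set" where
  "bose_line l = {emb a b c | a b c. ldot l a = 0 \<and> ldot l b = 0 \<and> ldot l c = 0}"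

definition diag :: "'a \<Rightarrow> 'a ^ 3 \<Rightarrow> 'a ^ 9" where
  "diag \<theta> x = emb (\<theta> *s x) (\<theta> ^ q *s x) (\<theta> ^ q\<^sup>2 *s x)"

lemma emb_in_bose_line: "emb a b c \<in> bose_line l \<longleftrightarrow> ldot l a = 0 \<and> ldot l b = 0 \<and> ldot l c = 0"
  by (auto simp: bose_line_def emb_eq_iff)

lemma diag_linear:
  "diag \<theta> (x + y) = diag \<theta> x + diag \<theta> y" "diag \<theta> (k *s x) = k *s diag \<theta> x" "diag \<theta> 0 = 0"
  by (simp_all add: diag_def emb_linear(1)[symmetric] emb_linear(3,4) vector_add_ldistrib mult.commute)

lemma diag_eq_iff: "\<theta> \<noteq> 0 \<Longrightarrow> diag \<theta> x = diag \<theta> y \<longleftrightarrow> x = y"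
  by (auto simp: diag_def emb_eq_iff)

lemma linear_diag: "Vector_Spaces.linear (*s) (*s) (diag \<theta>)"
  by unfold_locales (simp_all add: diag_linear)

lemma subspace_scroll: "vec.subspace (scroll x)"
proof (rule vec.subspaceI)
  show "0 \<in> scroll x"
    unfolding scroll_def using emb_linear(4) by (auto intro!: exI[of _ 0])
  fix v w c assume v: "v \<in> scroll x"
  then obtain s t u where e: "v = emb (s *s x) (t *s x) (u *s x)" by (auto simp: scroll_def)
  show "c *s v \<in> scroll x" unfolding scroll_def e emb_linear(3) vector_smult_assoc by blast
  assume "w \<in> scroll x"
  then obtain s' t' u' where e': "w = emb (s' *s x) (t' *s x) (u' *s x)" by (auto simp: scroll_def)
  show "v + w \<in> scroll x"
    unfolding scroll_def e e' emb_linear(1)[symmetric] vec.scale_left_distrib[symmetric] by blast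
qed

lemma subspace_bose_line: "vec.subspace (bose_line l)"
proof (rule vec.subspaceI)
  show "0 \<in> bose_line l" using emb_in_bose_line[of 0 0 0 l] by (simp add: emb_linear ldot_linear)
  fix v w c assume "v \<in> bose_line l"
  then obtain a b d where v: "v = emb a b d" "ldot l a = 0" "ldot l b = 0" "ldot l d = 0"
    by (auto simp: bose_line_def)
  thus "c *s v \<in> bose_line l" by (simp add: emb_linear(3) emb_in_bose_line ldot_linear)
  assume "w \<in> bose_line l"
  then obtain a' b' d' where "w = emb a' b' d'" "ldot l a' = 0" "ldot l b' = 0" "ldot l d' = 0"
    by (auto simp: bose_line_def)
  thus "v + w \<in> bose_line l"
    using v by (simp add: emb_linear(1)[symmetric] emb_in_bose_line ldot_linear)
qed

lemma dim_scroll: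
  assumes "x \<noteq> 0"
  shows "vec.dim (scroll x) = 3"
proof -
  let ?f = "\<lambda>w :: 'a ^ 3. emb (w $ 1 *s x) (w $ 2 *s x) (w $ 3 *s x)"
  have "Vector_Spaces.linear (*s) (*s) ?f"
    by unfold_locales (simp_all add: emb_linear(1)[symmetric] emb_linear(3) vec.scale_left_distrib)
  moreover have "inj ?f"
    using assms by (auto simp: inj_def emb_eq_iff vec_eq_iff[where 'b = 3] forall_3)
  ultimately have "vec.dim (range ?f) = vec.dim (UNIV :: ('a ^ 3) set)"
    by (intro vec.dim_image_eq) auto
  moreover have "range ?f = scroll x"
  proof (intro set_eqI iffI)
    fix v assume "v \<in> scroll x"
    then obtain s t u where "v = emb (s *s x) (t *s x) (u *s x)" by (auto simp: scroll_def)
    hence "v = ?f (vector [s, t, u])" by simp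
    thus "v \<in> range ?f" by blast
  qed (auto simp: scroll_def)
  ultimately show ?thesis by (simp only: vec_dim_card) simp
qed

text \<open>The scroll of a vector off the line is a complement of dimension 3 in the 9-dimensional
  space.\<close>

lemma dim_bose_line:
  assumes "l \<noteq> 0"
  shows "vec.dim (bose_line l) = 6"
proof -
  obtain i where i: "ldot l (axis i 1) \<noteq> 0" using ldot_nonzero[OF assms] .
  let ?p = "axis i 1 :: 'a ^ 3"
  have "{x + y |x y. x \<in> bose_line l \<and> y \<in> scroll ?p} = UNIV"
  proof -
    have "\<exists>x y. v = x + y \<and> x \<in> bose_line l \<and> y \<in> scroll ?p" for v
    proof -
      obtain a b c where v: "v = emb a b c" using emb_surj by blast
      let ?r = "\<lambda>a. (ldot l a / ldot l ?p) *s ?p"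
      have "v = emb (a - ?r a) (b - ?r b) (c - ?r c) + emb (?r a) (?r b) (?r c)"
        by (simp add: v emb_linear(1)[symmetric])
      moreover have "emb (a - ?r a) (b - ?r b) (c - ?r c) \<in> bose_line l"
        using i by (simp add: emb_in_bose_line ldot_linear)
      moreover have "emb (?r a) (?r b) (?r c) \<in> scroll ?p" unfolding scroll_def by blast
      ultimately show ?thesis by blast
    qed
    thus ?thesis by auto
  qed
  moreover have "bose_line l \<inter> scroll ?p = {0}"
  proof -
    have "v = 0" if "v \<in> bose_line l" "v \<in> scroll ?p" for v
    proof -
      obtain s t u where "v = emb (s *s ?p) (t *s ?p) (u *s ?p)" using \<open>v \<in> scroll ?p\<close> unfolding scroll_def by blast
      thus ?thesis using that(1) i by (simp add: emb_in_bose_line ldot_linear emb_linear(4))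
    qed
    thus ?thesis using vec.subspace_0[OF subspace_bose_line[of l]] vec.subspace_0[OF subspace_scroll[of ?p]] by auto
  qed
  ultimately have "vec.dim (UNIV :: ('a ^ 9) set) + vec.dim {0 :: 'a ^ 9} = vec.dim (bose_line l) + 3"
    using vec.dim_sums_Int[OF subspace_bose_line[of l] subspace_scroll[of ?p]] dim_scroll[of ?p] by simp
  thus ?thesis unfolding vec_dim_card by simp
qed

text \<open>The 6-space is spanned by its part at infinity and one more vector over order q.
  Frobenius fixes that vector and shifts the blocks, so the values of \<open>l\<close> on its three
  coordinates are successive q-th powers of one element \<open>\<theta>\<close>.\<close>

lemma hyperplane_coords:
  assumes l: "l \<in> vecs_over q 1" "l \<noteq> 0" and W: "proj_subspace q 1 6 W" "bose_line l \<subseteq> W"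
  obtains \<theta> where "\<theta> \<in> subfld q 3" "\<theta> \<noteq> 0"
    "\<And>a b c. emb a b c \<in> W \<longleftrightarrow> (\<exists>k. ldot l a = k * \<theta> \<and> ldot l b = k * \<theta> ^ q \<and> ldot l c = k * \<theta> ^ q\<^sup>2)"
proof -
  obtain S where S: "S \<subseteq> vecs_over q 1" "W = vec.span S" "vec.dim W = 7"
    using W(1) by (auto simp: proj_subspace_def)
  have "\<not> S \<subseteq> bose_line l"
  proof
    assume "S \<subseteq> bose_line l"
    hence "W \<subseteq> bose_line l" unfolding S(2) by (intro vec.span_minimal subspace_bose_line)
    hence "vec.dim W \<le> vec.dim (bose_line l)" by (rule vec.dim_subset)
    thus False using S(3) dim_bose_line[OF l(2)] by simp
  qed
  then obtain v where v: "v \<in> S" "v \<notin> bose_line l" by blast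
  obtain a b c where e: "v = emb a b c" using emb_surj by blast
  have "v \<in> vecs_over q 1" using S v by blast
  hence abc: "a = frob q c" "b = frob q a" "c = frob q b" unfolding e emb_over_1 by blast+
  define \<theta> where "\<theta> = ldot l a"
  have lb: "ldot l b = \<theta> ^ q" unfolding abc(2) \<theta>_def by (rule ldot_frob[OF l(1)])
  have lc: "ldot l c = \<theta> ^ q\<^sup>2" by (subst abc(3)) (simp add: ldot_frob[OF l(1)] lb pow_q2)
  \<comment> \<open>The third shift returns to the first block; this closes the cycle and puts
    \<open>\<theta>\<close> into the field of order q^3.\<close>
  have "\<theta> = (ldot l c) ^ q" unfolding \<theta>_def by (subst abc(1)) (rule ldot_frob[OF l(1)])
  hence tF: "\<theta> \<in> subfld q 3" by (simp add: subfld_def lc pow_q2 pow_q3)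
  have t0: "\<theta> \<noteq> 0" using v(2) lb lc q_gt_1 by (auto simp: e emb_in_bose_line \<theta>_def[symmetric] power_0_left)
  have vW: "v \<in> W" unfolding S using v(1) by (rule vec.span_base)
  have sW: "vec.subspace W" by (simp add: S(2))
  have cs: "vec.span (bose_line l) = bose_line l" using subspace_bose_line vec.span_eq_iff by blast
  have "vec.dim (insert v (bose_line l)) = 7"
    using v(2) by (simp add: vec.dim_insert cs dim_bose_line[OF l(2)])
  hence "vec.dim (vec.span (insert v (bose_line l))) \<ge> vec.dim W" using S(3) by simp
  moreover have "vec.span (insert v (bose_line l)) \<subseteq> W"
    using vW W(2) by (intro vec.span_minimal sW) auto
  ultimately have Weq: "W = vec.span (insert v (bose_line l))"
    using vec.subspace_dim_equal[OF vec.subspace_span sW] by blast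
  have mem: "x \<in> W \<longleftrightarrow> (\<exists>k. x - k *s v \<in> bose_line l)" for x
    unfolding Weq vec.span_insert cs by simp
  show ?thesis
    by (rule that[OF tF t0])
      (simp add: mem e emb_linear(3) emb_linear(2)[symmetric] emb_in_bose_line ldot_linear \<theta>_def[symmetric] lb lc)
qed

text \<open>Frobenius cycles the multipliers of \<open>diag \<theta>\<close> in the same way as the
  blocks, so it commutes with \<open>diag \<theta>\<close>.\<close>

lemma diag_over:
  assumes \<theta>: "\<theta> \<in> subfld q 3" "\<theta> \<noteq> 0"
  shows "diag \<theta> x \<in> vecs_over q 1 \<longleftrightarrow> x \<in> vecs_over q 1"
    "diag \<theta> x \<in> vecs_over q 3 \<longleftrightarrow> x \<in> vecs_over q 3"
proof -
  have t3: "((\<theta> ^ q) ^ q) ^ q = \<theta>" using \<theta> by (simp add: subfld_def pow_q3)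
  have "x \<in> vecs_over q 1 \<longleftrightarrow> x = frob q x" using vecs_over_iff[of x 1] by auto
  thus "diag \<theta> x \<in> vecs_over q 1 \<longleftrightarrow> x \<in> vecs_over q 1"
    using \<theta>(2) unfolding diag_def emb_over_1 by (auto simp: frob_scale pow_q2 t3)
  have c: "c *s x \<in> vecs_over q 3 \<longleftrightarrow> x \<in> vecs_over q 3" if "c \<in> subfld q 3" "c \<noteq> 0" for c
    using vecs_over_closed(3)[OF _ that(1), of x] vecs_over_closed(3)[OF _ subfld_unary(2)[OF that(1)], of "c *s x"] that(2)
    by (auto simp: vector_smult_assoc)
  have "\<theta> ^ q \<in> subfld q 3" "\<theta> ^ q\<^sup>2 \<in> subfld q 3" "\<theta> ^ q \<noteq> 0" "\<theta> ^ q\<^sup>2 \<noteq> 0"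
    using \<theta> by (auto intro: subfld_unary)
  thus "diag \<theta> x \<in> vecs_over q 3 \<longleftrightarrow> x \<in> vecs_over q 3"
    using \<theta> by (simp add: diag_def emb_over_3 c)
qed

lemma diag_plane:
  assumes \<theta>: "\<theta> \<in> subfld q 3" "\<theta> \<noteq> 0"
  shows "proj_subspace q 1 2 (range (diag \<theta>))"
proof -
  have "range (diag \<theta>) = vec.span (diag \<theta> ` cart_basis)"
    using vec.linear_span_image[OF linear_diag, of \<theta> cart_basis] by simp
  moreover have "diag \<theta> ` cart_basis \<subseteq> vecs_over q 1"
    using diag_over(1)[OF \<theta>] axis_over by (auto simp: cart_basis_def simp del: One_nat_def)
  moreover have "vec.dim (range (diag \<theta>)) = vec.dim (UNIV :: ('a ^ 3) set)"
    using linear_diag by (rule vec.dim_image_eq) (use diag_eq_iff[OF \<theta>(2)] in \<open>auto simp: inj_on_def\<close>)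
  hence "vec.dim (range (diag \<theta>)) = 2 + 1" by (simp only: vec_dim_card) simp
  ultimately show ?thesis unfolding proj_subspace_def by blast
qed

text \<open>
  The map \<open>R\<close> in the proof, a trace twisted by \<open>\<tau>\<close>, commutes with the Frobenius map and inverts
  \<open>diag \<theta>\<close> up to a scalar; the conic is the pullback of the standard one along \<open>R\<close>.
\<close>

lemma diag_conic:
  assumes \<theta>: "\<theta> \<in> subfld q 3" "\<theta> \<noteq> 0"
  obtains N where "mat_over q 1 N" "nondegenerate_on (range (diag \<theta>)) N"
    "\<And>x. quad N (diag \<theta> x) = 0 \<longleftrightarrow> quad std_conic x = 0"
proof -
  obtain \<tau> where \<tau>: "\<tau> \<in> subfld q 3" "\<tau> * \<theta> + (\<tau> * \<theta>) ^ q + (\<tau> * \<theta>) ^ q\<^sup>2 \<noteq> 0"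
    using trace_nonzero[OF \<theta>] by blast
  define \<kappa> where "\<kappa> = \<tau> * \<theta> + (\<tau> * \<theta>) ^ q + (\<tau> * \<theta>) ^ q\<^sup>2"
  have t3: "((\<tau> ^ q) ^ q) ^ q = \<tau>" using \<tau> by (simp add: subfld_def pow_q3)
  obtain fa fb fc where f: "\<And>v. v = emb (fa v) (fb v) (fc v)" using emb_surj by metis
  define R where "R v = \<tau> *s fa v + \<tau> ^ q *s fb v + \<tau> ^ q\<^sup>2 *s fc v" for v
  have R: "R (emb a b c) = \<tau> *s a + \<tau> ^ q *s b + \<tau> ^ q\<^sup>2 *s c" for a b c
    using f[of "emb a b c"] by (simp add: R_def emb_eq_iff)
  have lin: "Vector_Spaces.linear (*s) (*s) R"
  proof unfold_locales
    fix v w :: "'a ^ 9" and k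
    obtain a b c where v: "v = emb a b c" using emb_surj by blast
    obtain a' b' c' where w: "w = emb a' b' c'" using emb_surj by blast
    show "R (v + w) = R v + R w"
      unfolding v w emb_linear(1)[symmetric] R by (simp add: vector_add_ldistrib)
    show "R (k *s v) = k *s R v"
      unfolding v emb_linear(3) R by (simp add: vector_add_ldistrib mult.commute)
  qed
  have fR: "R (frob q v) = frob q (R v)" for v
  proof -
    obtain a b c where v: "v = emb a b c" using emb_surj by blast
    show ?thesis unfolding v frob_emb R by (simp add: frob_add frob_scale pow_q2 t3)
  qed
  define L where "L = matrix R"
  have L: "L *v v = R v" for v unfolding L_def by (rule matrix_works[OF lin])
  \<comment> \<open>The axis vectors are fixed by Frobenius, and \<open>R\<close> commutes with it;
    so the columns of the matrix of \<open>R\<close> lie over order q.\<close>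
  have "R (axis j 1) \<in> vecs_over q 1" for j
    using axis_over[of j 1] fR[of "axis j 1"] vecs_over_iff[of "axis j 1 :: 'a ^ 9" 1] vecs_over_iff[of "R (axis j 1)" 1]
    by simp
  hence LF: "mat_over q 1 L" unfolding mat_over_def L_def matrix_def vecs_over_def by simp
  define N where "N = transpose L ** std_conic ** L"
  have NF: "mat_over q 1 N"
    unfolding N_def by (intro mat_over_mult mat_over_transpose LF std_conic_over)
  \<comment> \<open>On this plane \<open>R\<close> multiplies by the trace of
    \<open>\<tau> * \<theta>\<close>, and \<open>\<tau>\<close> was chosen to make that trace
    nonzero.\<close>
  have Rd: "R (diag \<theta> x) = \<kappa> *s x" for x
    unfolding diag_def R vector_smult_assoc vec.scale_left_distrib[symmetric]
    by (simp add: \<kappa>_def power_mult_distrib)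
  have qN: "quad N (diag \<theta> x) = \<kappa>\<^sup>2 * quad std_conic x" for x
    by (simp add: N_def quad_compose L Rd quad_scale)
  have pN: "polar N (diag \<theta> x) (diag \<theta> y) = \<kappa> * (\<kappa> * polar std_conic x y)" for x y
    by (simp only: N_def polar_compose L Rd polar_linear(2) polar_scale_left)
  have k0: "\<kappa> \<noteq> 0" using \<tau>(2) by (simp add: \<kappa>_def)
  have "nondegenerate_on (range (diag \<theta>)) N"
    unfolding nondegenerate_on_def
  proof (intro ballI impI, elim conjE)
    fix v assume "v \<in> range (diag \<theta>)" "v \<noteq> 0" "quad N v = 0"
    then obtain x where v: "v = diag \<theta> x" "diag \<theta> x \<noteq> 0" "quad N (diag \<theta> x) = 0" by blast
    hence x: "v = diag \<theta> x" "x \<noteq> 0" "quad std_conic x = 0"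
      using k0 diag_linear(3)[of \<theta>] by (auto simp: qN)
    then obtain y where "polar std_conic x y \<noteq> 0" by (metis std_conic_nondegenerate)
    hence "polar N v (diag \<theta> y) \<noteq> 0" using k0 x by (simp add: pN)
    thus "\<exists>y\<in>range (diag \<theta>). polar N v y \<noteq> 0" by blast
  qed
  thus ?thesis using that[OF NF] k0 by (simp add: qN)
qed

text \<open>
  The three transversal vectors are obtained from rational ones by Lagrange interpolation at the
  conjugates of an element \<open>t\<close> of the cubic extension.
\<close>

lemma scroll_plane_over_1:
  assumes x: "x \<in> vecs_over q 1" "x \<noteq> 0"
  shows "proj_subspace q 1 2 (scroll x)"
proof -
  obtain t :: 'a where t: "t \<in> subfld q 3" "t ^ q \<noteq> t" "t ^ q\<^sup>2 \<noteq> t" "t ^ q\<^sup>2 \<noteq> t ^ q"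
    by (rule subfld_3_generator)
  define w where "w s = emb (s *s x) (s ^ q *s x) (s ^ q\<^sup>2 *s x)" for s
  define S where "S = {w 1, w t, w (t\<^sup>2)}"
  have fx: "frob q x = x" using x vecs_over_iff[of x 1] by simp
  have wF: "w s \<in> vecs_over q 1" if "s \<in> subfld q 3" for s
    using that unfolding w_def emb_over_1 by (simp add: frob_scale fx pow_q2 subfld_def pow_q3)
  have SF: "S \<subseteq> vecs_over q 1"
    using wF[of 1] wF[OF t(1)] wF[OF subfld_unary(3)[OF t(1), of 2]] subfld_01(2)[of 3] by (auto simp: S_def)
  \<comment> \<open>The coefficients are those of (z - b) (z - c), evaluated at the three conjugates
    of \<open>t\<close> in the three blocks; taking two of the conjugates for \<open>b\<close> and
    \<open>c\<close> leaves a single block.\<close>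
  have comb: "w (t\<^sup>2) - (b + c) *s w t + (b * c) *s w 1 =
      emb (((t - b) * (t - c)) *s x) (((t ^ q - b) * (t ^ q - c)) *s x) (((t ^ q\<^sup>2 - b) * (t ^ q\<^sup>2 - c)) *s x)" for b c
  proof -
    have sq: "t\<^sup>2 ^ n = (t ^ n)\<^sup>2" for n by (metis power_mult mult.commute)
    have "(z - b) * (z - c) = z\<^sup>2 - (b + c) * z + b * c * 1" for z
      by (simp add: power2_eq_square algebra_simps)
    thus ?thesis
      unfolding w_def emb_linear(3) emb_linear(1,2)[symmetric] sq
      by (simp add: vec.scale_left_diff_distrib vec.scale_left_distrib mult.assoc)
  qed
  have in_span: "w (t\<^sup>2) - (b + c) *s w t + (b * c) *s w 1 \<in> vec.span S" for b c
    unfolding S_def by (intro vec.span_add vec.span_diff vec.span_scale vec.span_base) auto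
  have unit: "emb x 0 0 \<in> vec.span S" "emb 0 x 0 \<in> vec.span S" "emb 0 0 x \<in> vec.span S"
  proof -
    have *: "v \<in> vec.span S" if "d \<noteq> 0" "d *s v \<in> vec.span S" for d v
      using vec.span_scale[OF that(2), of "inverse d"] that(1) by simp
    have "((t - t ^ q) * (t - t ^ q\<^sup>2)) *s emb x 0 0 \<in> vec.span S"
      using in_span[of "t ^ q" "t ^ q\<^sup>2", unfolded comb] by (simp add: emb_linear(3))
    thus "emb x 0 0 \<in> vec.span S" by (rule *[rotated]) (use t(2-4) in auto)
    have "((t ^ q - t) * (t ^ q - t ^ q\<^sup>2)) *s emb 0 x 0 \<in> vec.span S"
      using in_span[of t "t ^ q\<^sup>2", unfolded comb] by (simp add: emb_linear(3))
    thus "emb 0 x 0 \<in> vec.span S" by (rule *[rotated]) (use t(2-4) in auto)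
    have "((t ^ q\<^sup>2 - t) * (t ^ q\<^sup>2 - t ^ q)) *s emb 0 0 x \<in> vec.span S"
      using in_span[of t "t ^ q", unfolded comb] by (simp add: emb_linear(3))
    thus "emb 0 0 x \<in> vec.span S" by (rule *[rotated]) (use t(2-4) in auto)
  qed
  have "scroll x = vec.span S"
  proof
    show "vec.span S \<subseteq> scroll x"
    proof -
      have "w s \<in> scroll x" for s unfolding w_def scroll_def by blast
      thus ?thesis by (intro vec.span_minimal subspace_scroll) (auto simp: S_def)
    qed
    show "scroll x \<subseteq> vec.span S"
    proof
      fix v assume "v \<in> scroll x"
      then obtain s t u where "v = emb (s *s x) (t *s x) (u *s x)" by (auto simp: scroll_def)
      hence "v = s *s emb x 0 0 + t *s emb 0 x 0 + u *s emb 0 0 x"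
        by (simp add: emb_linear(3) emb_linear(1)[symmetric])
      thus "v \<in> vec.span S" using unit by (simp add: vec.span_add vec.span_scale)
    qed
  qed
  moreover have "vec.dim (scroll x) = 2 + 1" using x(2) by (simp add: dim_scroll)
  ultimately show ?thesis using SF unfolding proj_subspace_def by blast
qed

lemma scroll_plane_over_6: "x \<noteq> 0 \<Longrightarrow> proj_subspace q 6 2 (scroll x)"
proof -
  assume "x \<noteq> 0"
  moreover have "scroll x = vec.span (scroll x)" using subspace_scroll[of x] vec.span_eq_iff by blast
  moreover have "scroll x \<subseteq> vecs_over q 6" using vecs_over_6 by blast
  moreover have "vec.dim (scroll x) = 2 + 1" using calculation(1) by (simp add: dim_scroll)
  ultimately show ?thesis unfolding proj_subspace_def by blast
qed

text \<open>Frobenius swaps \<open>y\<close> and \<open>z\<close>, and so does its cube. A nonzero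
  multiple of \<open>y\<close> over order q^3 would be fixed by the cube and make \<open>y\<close>
  and \<open>z\<close> proportional.\<close>

lemma scroll_no_points:
  assumes y: "frob q y = z" "frob q z = y" "z \<noteq> 0" "\<And>c. c *s y = z \<Longrightarrow> c = 0"
    and v: "v \<in> scroll y" "v \<in> vecs_over q 3"
  shows "v = 0"
proof -
  have y3: "frob (q ^ 3) y = z" by (simp add: frob3 y)
  have "s = 0" if "s *s y \<in> vecs_over q 3" for s
  proof (rule ccontr)
    assume s: "s \<noteq> 0"
    have "s ^ (q ^ 3) *s z = s *s y"
      using that by (simp add: vecs_over_iff frob_scale y3)
    hence "(s / s ^ (q ^ 3)) *s y = inverse (s ^ (q ^ 3)) *s (s ^ (q ^ 3) *s z)"
      by (simp add: divide_inverse mult.commute)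
    also have "\<dots> = z" using s by simp
    finally have "s / s ^ (q ^ 3) = 0" by (rule y(4))
    thus False using s by simp
  qed
  moreover obtain s t u where "v = emb (s *s y) (t *s y) (u *s y)" using v(1) by (auto simp: scroll_def)
  ultimately have "s = 0" "t = 0" "u = 0" "v = emb (s *s y) (t *s y) (u *s y)"
    using v(2) by (simp_all add: emb_over_3)
  thus ?thesis by (simp add: emb_linear(4))
qed

lemma conjugate_scrolls_no_points:
  assumes y: "z = frob q y" "y = frob q z" "y \<noteq> 0" "z \<noteq> 0" "\<forall>c. c *s y = z \<longrightarrow> c = 0"
    and v: "v \<in> scroll y \<or> v \<in> scroll z" "v \<in> vecs_over q 3"
  shows "v = 0"
proof -
  have "c = 0" if "c *s z = y" for c
  proof (rule ccontr)
    assume "c \<noteq> 0"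
    hence "inverse c *s y = z" using that by auto
    thus False using y(5) \<open>c \<noteq> 0\<close> by force
  qed
  thus ?thesis
    using v scroll_no_points[of y z v] scroll_no_points[of z y v] y by metis
qed

section \<open>Incidence of scroll planes with the 6-space\<close>

lemma emb_split: "emb a b c = emb a 0 0 + emb 0 b 0 + emb 0 0 c"
  by (simp add: emb_linear(1)[symmetric])

lemma image_span_emb:
  assumes "H = M ** A"
  shows "(*v) M ` vec.span {A *v x} = vec.span {emb x 0 0}"
    "frob q ` (*v) M ` vec.span {A *v x} = vec.span {emb 0 (frob q x) 0}"
    "frob (q\<^sup>2) ` (*v) M ` vec.span {A *v x} = vec.span {emb 0 0 (frob (q\<^sup>2) x)}"
proof -
  have e: "M *v (A *v x) = H *v x" by (simp add: assms matrix_vector_mul_assoc)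
  show "(*v) M ` vec.span {A *v x} = vec.span {emb x 0 0}"
    unfolding image_span_singleton e by (simp add: emb_def)
  show "frob q ` (*v) M ` vec.span {A *v x} = vec.span {emb 0 (frob q x) 0}"
    unfolding image_span_singleton e frob_image_span[OF qpow_simps(2)] frob_H by (simp add: emb_def)
  show "frob (q\<^sup>2) ` (*v) M ` vec.span {A *v x} = vec.span {emb 0 0 (frob (q\<^sup>2) x)}"
    unfolding image_span_singleton e frob_image_span[OF qpow_simps(1)] frob_H by (simp add: emb_def)
qed

lemma span_emb_three:
  "vec.span (vec.span {emb x 0 0} \<union> vec.span {emb 0 y 0} \<union> vec.span {emb 0 0 z})
    = {emb (s *s x) (t *s y) (u *s z) | s t u. True}"
proof -
  have "s *s emb x 0 0 + t *s emb 0 y 0 + u *s emb 0 0 z = emb (s *s x) (t *s y) (u *s z)" for s t u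
    unfolding emb_linear(3) emb_linear(1)[symmetric] by simp
  thus ?thesis unfolding span_three by simp
qed

lemma bose_span_point:
  assumes "H = M ** A"
  shows "bose_span q M (vec.span {A *v x}) =
    {emb (s *s x) (t *s frob q x) (u *s frob (q\<^sup>2) x) | s t u. True}"
  unfolding bose_span_def image_span_emb(2,3)[OF assms]
  unfolding image_span_emb(1)[OF assms] by (rule span_emb_three)

text \<open>The Frobenius twists fix \<open>x\<close>, so over order q the Bose planes are
  scroll-planes and one description fits all three fields.\<close>

lemma bose_span_point_over_1:
  assumes "H = M ** A" "x \<in> vecs_over q 1"
  shows "bose_span q M (vec.span {A *v x}) = scroll x"
proof -
  have "frob q x = x" using assms(2) vecs_over_iff[of x 1] by simp
  moreover from this have "frob (q\<^sup>2) x = x" by (metis frob_frob power2_eq_square)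
  ultimately show ?thesis unfolding bose_span_point[OF assms(1)] scroll_def by simp
qed

text \<open>Conjugacy acts on \<open>x\<close> as Frobenius, and 5 + 1 = 4 + 2 = 6: each twisted
  generator carries the sixth power of Frobenius, which is trivial.\<close>

lemma scroll_plane_point:
  assumes "H = M ** A"
    and conj: "\<And>n x. (conj_map q B ^^ n) (vec.span {A *v x}) = vec.span {A *v frob (q ^ n) x}"
  shows "scroll_plane q M B (vec.span {A *v x}) = scroll x"
proof -
  have "frob (q ^ 6) x = x" by (simp add: frob_def vec_eq_iff pow6)
  hence "frob q (frob (q ^ 5) x) = x" "frob (q\<^sup>2) (frob (q ^ 4) x) = x"
    unfolding frob_frob by (simp_all add: power_add[symmetric] power_Suc2[symmetric] del: power_Suc)
  thus ?thesis
    unfolding scroll_plane_def conj image_span_emb(2,3)[OF assms(1)]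
    unfolding image_span_emb(1)[OF assms(1)] span_emb_three scroll_def by simp
qed

text \<open>The kernel of \<open>l\<close> is stable under Frobenius because \<open>l\<close> is, so
  each block satisfies the same equation; Frobenius is onto, so each block takes all
  solutions.\<close>

lemma bose_span_line:
  assumes HM: "H = M ** A" and l: "l \<in> vecs_over q 1"
  shows "bose_span q M ((*v) A ` {x. ldot l x = 0}) = bose_line l"
proof
  let ?K = "(*v) A ` {x. ldot l x = 0}"
  have e: "M *v (A *v x) = emb x 0 0" "frob q (M *v (A *v x)) = emb 0 (frob q x) 0"
    "frob (q\<^sup>2) (M *v (A *v x)) = emb 0 0 (frob (q\<^sup>2) x)" for x
  proof -
    have "M *v (A *v x) = H *v x" by (simp add: HM matrix_vector_mul_assoc)
    thus "M *v (A *v x) = emb x 0 0" "frob q (M *v (A *v x)) = emb 0 (frob q x) 0"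
      "frob (q\<^sup>2) (M *v (A *v x)) = emb 0 0 (frob (q\<^sup>2) x)"
      by (simp_all add: frob_H) (simp_all add: emb_def)
  qed
  have f2: "frob (q\<^sup>2) x = frob q (frob q x)" for x :: "'a ^ 3"
    by (simp add: frob_frob power2_eq_square)
  have lf: "ldot l (frob q x) = 0 \<longleftrightarrow> ldot l x = 0" for x
    using q_gt_1 by (simp add: ldot_frob[OF l])
  have "M *v (A *v x) \<in> bose_line l" "frob q (M *v (A *v x)) \<in> bose_line l"
    "frob (q\<^sup>2) (M *v (A *v x)) \<in> bose_line l" if "ldot l x = 0" for x
    unfolding e(2,3) unfolding e(1) using that by (simp_all add: emb_in_bose_line ldot_linear lf f2)
  thus "bose_span q M ?K \<subseteq> bose_line l"
    unfolding bose_span_def by (intro vec.span_minimal subspace_bose_line) blast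
  show "bose_line l \<subseteq> bose_span q M ?K"
  proof
    fix v assume "v \<in> bose_line l"
    then obtain a b c where v: "v = emb a b c" "ldot l a = 0" "ldot l b = 0" "ldot l c = 0"
      by (auto simp: bose_line_def)
    obtain b' where b: "b = frob q b'" using frob_surj[of q b] by auto
    obtain c' where c: "c = frob (q\<^sup>2) c'" using frob_surj[of "q\<^sup>2" c] by auto
    have "A *v a \<in> ?K" "A *v b' \<in> ?K" "A *v c' \<in> ?K" using v(2-4) by (auto simp: b c lf f2)
    hence "emb a 0 0 \<in> bose_span q M ?K" "emb 0 b 0 \<in> bose_span q M ?K" "emb 0 0 c \<in> bose_span q M ?K"
      unfolding b c bose_span_def e(1)[of a, symmetric] e(2)[of b', symmetric] e(3)[of c', symmetric]
      by (blast intro: vec.span_base)+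
    thus "v \<in> bose_span q M ?K"
      unfolding v(1) emb_split[of a b c] bose_span_def by (intro vec.span_add)
  qed
qed

lemma incidence:
  assumes l: "l \<in> vecs_over q 1" and \<theta>: "\<theta> \<in> subfld q 3" "\<theta> \<noteq> 0"
    and W: "\<And>a b c. emb a b c \<in> W \<longleftrightarrow> (\<exists>k. ldot l a = k * \<theta> \<and> ldot l b = k * \<theta> ^ q \<and> ldot l c = k * \<theta> ^ q\<^sup>2)"
    and yz: "y \<noteq> 0" "z \<noteq> 0" "quad std_conic y = 0" "quad std_conic z = 0" "ldot l y = 0" "ldot l z = 0"
    and all: "\<And>x. quad std_conic x = 0 \<Longrightarrow> ldot l x = 0 \<Longrightarrow> \<exists>c. x = c *s y \<or> x = c *s z"
    and rat: "y \<in> vecs_over q 1 \<and> z \<in> vecs_over q 1 \<or> z = frob q y \<and> y = frob q z \<and> (\<forall>c. c *s y = z \<longrightarrow> c = 0)"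
    and k: "k \<in> {1, 3, 6}" and v: "v \<in> vecs_over q k" "v \<noteq> 0"
  shows "v \<in> W \<and> (\<exists>x. x \<in> vecs_over q k \<and> x \<noteq> 0 \<and> quad std_conic x = 0 \<and> v \<in> scroll x) \<longleftrightarrow>
    (\<exists>x. v = diag \<theta> x \<and> quad std_conic x = 0) \<or> v \<in> scroll y \<or> v \<in> scroll z"
proof
  assume "v \<in> W \<and> (\<exists>x. x \<in> vecs_over q k \<and> x \<noteq> 0 \<and> quad std_conic x = 0 \<and> v \<in> scroll x)"
  then obtain x where x: "v \<in> W" "x \<noteq> 0" "quad std_conic x = 0" "v \<in> scroll x" by blast
  then obtain s t u where e: "v = emb (s *s x) (t *s x) (u *s x)" by (auto simp: scroll_def)
  show "(\<exists>x. v = diag \<theta> x \<and> quad std_conic x = 0) \<or> v \<in> scroll y \<or> v \<in> scroll z"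
  proof (cases "ldot l x = 0")
    case True
    then obtain c where "x = c *s y \<or> x = c *s z" using all[OF x(3)] by blast
    thus ?thesis unfolding e scroll_def by (metis (mono_tags, lifting) mem_Collect_eq vector_smult_assoc)
  next
    case False
    obtain m where "s * ldot l x = m * \<theta>" "t * ldot l x = m * \<theta> ^ q" "u * ldot l x = m * \<theta> ^ q\<^sup>2"
      using x(1) W unfolding e by (auto simp: ldot_linear)
    hence "s = \<theta> * (m / ldot l x)" "t = \<theta> ^ q * (m / ldot l x)" "u = \<theta> ^ q\<^sup>2 * (m / ldot l x)"
      using False by (simp_all add: field_simps)
    \<comment> \<open>The common factor is moved into the vector, which stays on the conic because
      the form is homogeneous.\<close>
    hence "v = diag \<theta> ((m / ldot l x) *s x)" by (simp only: e diag_def vector_smult_assoc)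
    moreover have "quad std_conic ((m / ldot l x) *s x) = 0" by (simp add: quad_scale x(3))
    ultimately show ?thesis by blast
  qed
next
  have lineW: "w \<in> W" if "w \<in> scroll x" "ldot l x = 0" for w x
  proof -
    obtain s t u where "w = emb (s *s x) (t *s x) (u *s x)" using \<open>w \<in> scroll x\<close> by (auto simp: scroll_def)
    thus ?thesis using that(2) by (auto simp: W ldot_linear intro: exI[of _ 0])
  qed
  \<comment> \<open>Only a conjugate pair can fail to be defined over order \<open>q ^ k\<close>,
    and only for k = 1 or 3. Then the two scroll-planes have no nonzero vector over order q^3, which
    excludes \<open>v\<close>.\<close>
  have over: "x \<in> vecs_over q k" if "v \<in> scroll x" "x = y \<or> x = z" for x
  proof (cases "y \<in> vecs_over q 1 \<and> z \<in> vecs_over q 1")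
    case True
    thus ?thesis using that(2) vecs_over_1_imp by blast
  next
    case False
    hence conj: "z = frob q y" "y = frob q z" "\<forall>c. c *s y = z \<longrightarrow> c = 0" using rat by blast+
    show ?thesis
    proof (cases "k = 6")
      case True
      thus ?thesis using vecs_over_6 by blast
    next
      case False
      hence "v \<in> vecs_over q 3" using k v(1) vecs_over_1_imp by auto
      hence "v = 0"
        using that conjugate_scrolls_no_points[OF conj(1,2) yz(1,2) conj(3)] by blast
      with v(2) show ?thesis by blast
    qed
  qed
  assume "(\<exists>x. v = diag \<theta> x \<and> quad std_conic x = 0) \<or> v \<in> scroll y \<or> v \<in> scroll z"
  then consider x where "v = diag \<theta> x" "quad std_conic x = 0" | "v \<in> scroll y" | "v \<in> scroll z" by blast
  thus "v \<in> W \<and> (\<exists>x. x \<in> vecs_over q k \<and> x \<noteq> 0 \<and> quad std_conic x = 0 \<and> v \<in> scroll x)"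
  proof cases
    case 1
    have "x \<in> vecs_over q k" using k v(1) vecs_over_6 diag_over[OF \<theta>, of x] unfolding 1 by auto
    moreover have "x \<noteq> 0" using v(2) 1 diag_linear(3) by auto
    moreover have "v \<in> scroll x" unfolding 1 diag_def scroll_def by blast
    moreover have "v \<in> W" unfolding 1 diag_def W by (auto simp: ldot_linear mult.commute)
    ultimately show ?thesis using 1(2) by blast
  next
    case 2
    thus ?thesis using lineW over yz by blast
  next
    case 3
    thus ?thesis using lineW over yz by blast
  qed
qed

text \<open>The first block alone already shows that \<open>y\<close> and \<open>z\<close> are
  proportional, whatever the twists in the other two.\<close>

lemma diag_in_bose_plane:
  assumes \<theta>: "\<theta> \<in> subfld q 3" "\<theta> \<noteq> 0" and HM: "H = M ** A"
    and v: "vec.span {diag \<theta> z} \<in> bose_plane q M (vec.span {A *v y})" "z \<noteq> 0"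
  shows "vec.span {A *v y} = vec.span {A *v z}"
proof -
  have "diag \<theta> z \<in> bose_span q M (vec.span {A *v y})"
    using v(1) vec.span_base[of "diag \<theta> z" "{diag \<theta> z}"] unfolding bose_plane_def points_def by auto
  then obtain s t u where "diag \<theta> z = emb (s *s y) (t *s frob q y) (u *s frob (q\<^sup>2) y)"
    unfolding bose_span_point[OF HM] by blast
  hence "\<theta> *s z = s *s y" unfolding diag_def emb_eq_iff by blast
  hence z: "z = (s / \<theta>) *s y"
    using \<theta>(2) by (metis divide_inverse mult.commute vector_smult_assoc right_inverse vector_smult_lid)
  hence "A *v z = (s / \<theta>) *s (A *v y)" by (simp add: vector_scalar_mult_commute)
  moreover have "s / \<theta> \<noteq> 0" using z v(2) by auto
  ultimately have "vec.span {A *v z} = vec.span {A *v y}" using span_singleton_eq_iff by blast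
  thus ?thesis by simp
qed

text \<open>The spread plane of a subplane point \<open>A x\<close> contains the point of
  \<open>diag \<theta> x\<close>. Conversely, a common point of a spread plane and the conic plane
  is some \<open>diag \<theta> z\<close> with \<open>z\<close> over order q, so that spread plane
  belongs to the subplane point \<open>A z\<close>.\<close>

lemma card_spread_planes:
  assumes HM: "H = M ** A" and A: "invertible A" and l: "l \<in> vecs_over q 1" and \<theta>: "\<theta> \<in> subfld q 3" "\<theta> \<noteq> 0"
    and g: "g = (*v) A ` {x. ldot l x = 0}"
  shows "card {S \<in> spread q M g. S \<inter> points q 1 (range (diag \<theta>)) \<noteq> {}}
    = card (points q 3 g \<inter> matrix_image A (PG q 1))"
proof -
  let ?X = "points q 3 g \<inter> matrix_image A (PG q 1)"
  have sE: "vec.subspace (range (diag \<theta>))"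
    using diag_plane[OF \<theta>] by (auto simp: proj_subspace_def)
  have sg: "vec.subspace g"
    unfolding g by (rule vec.linear_subspace_image[OF matrix_vector_mul_linear_gen subspace_ldot])
  have inc: "vec.span {diag \<theta> x} \<in> bose_plane q M (vec.span {A *v x})"
    "vec.span {diag \<theta> x} \<in> points q 1 (range (diag \<theta>))" if x: "x \<in> vecs_over q 1" "x \<noteq> 0" for x
  proof -
    have d: "diag \<theta> x \<in> vecs_over q 1" "diag \<theta> x \<noteq> 0"
      using diag_over(1)[OF \<theta>] x diag_eq_iff[OF \<theta>(2), of x 0] by (auto simp: diag_linear(3))
    have "diag \<theta> x \<in> scroll x" unfolding diag_def scroll_def by blast
    thus "vec.span {diag \<theta> x} \<in> bose_plane q M (vec.span {A *v x})"
      using d unfolding bose_plane_def bose_span_point_over_1[OF HM x(1)] points_iff[OF subspace_scroll] by blast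
    show "vec.span {diag \<theta> x} \<in> points q 1 (range (diag \<theta>))"
      using d unfolding points_iff[OF sE] by blast
  qed
  have "bij_betw (bose_plane q M) ?X {S \<in> spread q M g. S \<inter> points q 1 (range (diag \<theta>)) \<noteq> {}}"
  proof (rule bij_betw_imageI)
    show "inj_on (bose_plane q M) ?X"
    proof (rule inj_onI)
      fix P P' assume P: "P \<in> ?X" and P': "P' \<in> ?X" and eq: "bose_plane q M P = bose_plane q M P'"
      obtain x where x: "x \<in> vecs_over q 1" "x \<noteq> 0" "P = vec.span {A *v x}"
        using IntD2[OF P] unfolding matrix_image_PG_iff by blast
      obtain y where y: "P' = vec.span {A *v y}"
        using IntD2[OF P'] unfolding matrix_image_PG_iff by blast
      have "vec.span {diag \<theta> x} \<in> bose_plane q M (vec.span {A *v y})"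
        using inc(1)[OF x(1,2)] eq unfolding x y by simp
      from diag_in_bose_plane[OF \<theta> HM this x(2)] show "P = P'" by (simp add: x y)
    qed
    show "bose_plane q M ` ?X = {S \<in> spread q M g. S \<inter> points q 1 (range (diag \<theta>)) \<noteq> {}}"
    proof (intro set_eqI iffI)
      fix S assume "S \<in> bose_plane q M ` ?X"
      then obtain P where P: "S = bose_plane q M P" "P \<in> ?X" by blast
      obtain x where x: "x \<in> vecs_over q 1" "x \<noteq> 0" "P = vec.span {A *v x}"
        using IntD2[OF P(2)] unfolding matrix_image_PG_iff by blast
      show "S \<in> {S \<in> spread q M g. S \<inter> points q 1 (range (diag \<theta>)) \<noteq> {}}"
        using P inc[OF x(1,2)] unfolding spread_def x by blast
    next
      fix S assume "S \<in> {S \<in> spread q M g. S \<inter> points q 1 (range (diag \<theta>)) \<noteq> {}}"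
      then obtain P R where P: "P \<in> points q 3 g" "S = bose_plane q M P" "R \<in> S" "R \<in> points q 1 (range (diag \<theta>))"
        unfolding spread_def by blast
      obtain w where w: "P = vec.span {w}" "w \<in> g" using P(1) unfolding points_iff[OF sg] by blast
      then obtain y where y: "P = vec.span {A *v y}" unfolding g by blast
      obtain z where z: "R = vec.span {diag \<theta> z}" "diag \<theta> z \<in> vecs_over q 1" "diag \<theta> z \<noteq> 0"
        using P(4) unfolding points_iff[OF sE] by blast
      have z': "z \<in> vecs_over q 1" "z \<noteq> 0" using z diag_over(1)[OF \<theta>] diag_linear(3) by auto
      have "P = vec.span {A *v z}"
        using diag_in_bose_plane[OF \<theta> HM _ z'(2)] P(2,3) unfolding z(1) y by blast
      hence "P \<in> matrix_image A (PG q 1)" using z' unfolding matrix_image_PG_iff by blast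
      thus "S \<in> bose_plane q M ` ?X" using P by blast
    qed
  qed
  thus ?thesis by (simp add: bij_betw_same_card)
qed

end

section \<open>Decomposition of the section by the 6-space over the three fields\<close>

theorem theorem4p1:
  fixes q :: nat
    and \<Gamma> :: "('a::{field,finite} ^ 9) set"
    and M :: "'a ^ 3 ^ 9"
    and linf :: "('a ^ 3) set"
    and Sinf S6 :: "('a ^ 9) set"
    and \<pi> C :: "('a ^ 3) set set"
    and B :: "'a ^ 3 ^ 3"
    and Q :: "nat \<Rightarrow> 'a ^ 9 ^ 9"
  assumes "primepow q" and "q \<ge> 6" and "CARD('a) = q ^ 6"
    and "bose_setting q \<Gamma> M"
    and "proj_subspace q 3 1 linf"
    and "Sinf = bose_span q M linf"
    and "proj_subspace q 1 6 S6" and "Sinf \<subseteq> S6"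
    and "Fq_subplane q \<pi>" and "Fq_conic_in q \<pi> C" and "secant q \<pi> linf"
    and "conjugacy_matrix q \<pi> B"
    and "bose_conic_variety q M B C Q"
  shows "\<exists>E N \<alpha> \<beta>.
    proj_subspace q 1 2 E \<and> E \<subseteq> S6 \<and> \<not> E \<subseteq> Sinf \<and>
    card {S \<in> spread q M linf. S \<inter> points q 1 E \<noteq> {}} = q + 1 \<and>
    mat_over q 1 N \<and> nondegenerate_on E N \<and>
    proj_subspace q 6 2 \<alpha> \<and> \<alpha> \<subseteq> Sinf \<and> proj_subspace q 6 2 \<beta> \<and> \<beta> \<subseteq> Sinf \<and>
    (proj_subspace q 1 2 \<alpha> \<and> proj_subspace q 1 2 \<beta> \<or>
     points q 1 \<alpha> = {} \<and> points q 1 \<beta> = {}) \<and>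
    (\<forall>k\<in>{1, 3, 6}. variety q k Q \<inter> points q k S6 =
       (points q k E \<inter> quadric_points q k N) \<union> points q k \<alpha> \<union> points q k \<beta>)"
proof -
  interpret tower q "TYPE('a)" by unfold_locales (use assms(1,3) in auto)
  obtain A where A: "mat_over q 3 A" "invertible A" "\<pi> = matrix_image A (PG q 1)"
    "C = matrix_image A (quadric_points q 1 std_conic)"
    using Fq_conic_frame[OF assms(10)] by blast
  have M: "mat_over q 3 M" "range ((*v) M) = \<Gamma>"
    "vec.span (\<Gamma> \<union> frob q ` \<Gamma> \<union> frob (q\<^sup>2) ` \<Gamma>) = UNIV"
    using assms(4) by (auto simp: bose_setting_def bij_betw_def)
  have ran: "range ((*v) (M ** A)) = \<Gamma>"
  proof -
    have r: "range ((*v) A) = UNIV" using invertible_inv_vec(1)[OF A(2)] by (metis surjI)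
    have "(*v) (M ** A) = (*v) M \<circ> (*v) A" by (auto simp: matrix_vector_mul_assoc)
    thus ?thesis by (simp only: image_comp[symmetric] r M(2))
  qed
  \<comment> \<open>The invertible \<open>A\<close> only reparametrises \<open>\<Gamma>\<close>, so
    the spanning condition carries over from \<open>M\<close>.\<close>
  interpret bose q "TYPE('a)" "M ** A"
    by unfold_locales (use M A mat_over_mult in \<open>simp_all add: ran\<close>)
  have sec: "card (points q 3 linf \<inter> matrix_image A (PG q 1)) = q + 1"
    using assms(11) by (simp add: secant_def A(3))
  obtain l where l: "l \<in> vecs_over q 1" "l \<noteq> 0" "linf = (*v) A ` {x. ldot l x = 0}"
    using secant_line_kernel[OF A(2) assms(5)] sec q_gt_1 by auto
  have Sinf: "Sinf = bose_line l"
    unfolding assms(6) l(3) by (rule bose_span_line[OF refl l(1)])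
  have sub: "bose_line l \<subseteq> S6" using assms(8) Sinf by simp
  obtain \<theta> where \<theta>: "\<theta> \<in> subfld q 3" "\<theta> \<noteq> 0"
    and W: "\<And>a b c. emb a b c \<in> S6 \<longleftrightarrow> (\<exists>k. ldot l a = k * \<theta> \<and> ldot l b = k * \<theta> ^ q \<and> ldot l c = k * \<theta> ^ q\<^sup>2)"
    by (rule hyperplane_coords[OF l(1,2) assms(7) sub], rule that, assumption+)
  obtain y z where yz: "y \<noteq> 0" "z \<noteq> 0" "quad std_conic y = 0" "quad std_conic z = 0" "ldot l y = 0" "ldot l z = 0"
    and all: "\<And>x. quad std_conic x = 0 \<Longrightarrow> ldot l x = 0 \<Longrightarrow> \<exists>c. x = c *s y \<or> x = c *s z"
    and rat: "y \<in> vecs_over q 1 \<and> z \<in> vecs_over q 1 \<or> z = frob q y \<and> y = frob q z \<and> (\<forall>c. c *s y = z \<longrightarrow> c = 0)"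
    by (rule line_conic_points[OF l(1,2)], rule that, assumption+)
  obtain N where N: "mat_over q 1 N" "nondegenerate_on (range (diag \<theta>)) N"
    "\<And>x. quad N (diag \<theta> x) = 0 \<longleftrightarrow> quad std_conic x = 0"
    by (rule diag_conic[OF \<theta>], rule that, assumption+)
  obtain c where c: "c \<noteq> 0" "\<And>x. B *v frob q (A *v x) = c *s (A *v frob q x)"
    by (rule conjugacy_frame[OF assms(12) A(2,3)], rule that, assumption+)
  have "diag \<theta> x \<in> S6" for x
    unfolding diag_def W by (auto simp: ldot_linear mult.commute)
  hence ES6: "range (diag \<theta>) \<subseteq> S6" by blast
  have ESinf: "\<not> range (diag \<theta>) \<subseteq> Sinf"
  proof -
    obtain i where "ldot l (axis i 1) \<noteq> 0" using ldot_nonzero[OF l(2)] .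
    hence "diag \<theta> (axis i 1) \<notin> Sinf"
      using \<theta>(2) by (simp add: Sinf diag_def emb_in_bose_line ldot_linear)
    thus ?thesis by blast
  qed
  have sc_Sinf: "scroll x \<subseteq> Sinf" if "ldot l x = 0" for x
    using that by (auto simp: scroll_def Sinf emb_in_bose_line ldot_linear)
  \<comment> \<open>The dichotomy for the two points at infinity passes to their
    scroll-planes.\<close>
  have pts: "proj_subspace q 1 2 (scroll y) \<and> proj_subspace q 1 2 (scroll z) \<or>
     points q 1 (scroll y) = {} \<and> points q 1 (scroll z) = {}"
  proof (cases "y \<in> vecs_over q 1 \<and> z \<in> vecs_over q 1")
    case True
    thus ?thesis using scroll_plane_over_1 yz by blast
  next
    case False
    hence conj: "z = frob q y" "y = frob q z" "\<forall>c. c *s y = z \<longrightarrow> c = 0" using rat by blast+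
    show ?thesis
      using conjugate_scrolls_no_points[OF conj(1,2) yz(1,2) conj(3)] vecs_over_1_imp
      unfolding set_eq_iff points_iff[OF subspace_scroll] by blast
  qed
  have q5: "q \<ge> 5" using assms(2) by simp
  have mono: "matrix_image A (quadric_points q 1 std_conic) \<subseteq> matrix_image A (quadric_points q k std_conic)" for k
    by (rule image_mono) (use vecs_over_1_imp in \<open>unfold subset_iff quadric_points_iff, blast\<close>)
  have mono36: "matrix_image A (quadric_points q 3 std_conic) \<subseteq> matrix_image A (quadric_points q 6 std_conic)"
    by (rule image_mono) (use vecs_over_6 in \<open>unfold subset_iff quadric_points_iff, blast\<close>)
  \<comment> \<open>Both extensions are computed in the same frame; the second starts from the
    pointset over order q^3, which still contains the one over order q.\<close>
  have plus: "conic_plus q C = matrix_image A (quadric_points q 3 std_conic)"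
    unfolding A(4) by (rule conic_ext_eq[OF q5 A(1,2) order.refl mono])
  have plusplus: "conic_plusplus q C = matrix_image A (quadric_points q 6 std_conic)"
    unfolding plus by (rule conic_ext_eq[OF q5 mat_over_6 A(2) mono mono36])
  have scr: "scroll_plane q M B (vec.span {A *v x}) = scroll x" for x
    by (rule scroll_plane_point[OF refl conj_map_frame[OF c]])
  have var: "P \<in> variety q k Q \<longleftrightarrow>
      (\<exists>x. x \<in> vecs_over q k \<and> x \<noteq> 0 \<and> quad std_conic x = 0 \<and> P \<in> points q k (scroll x))"
    if k: "k \<in> {1, 3, 6}" for k P
  proof -
    have v: "variety q 1 Q = (\<Union>X\<in>C. bose_plane q M X)"
      "variety q 3 Q = (\<Union>X\<in>conic_plus q C. points q 3 (scroll_plane q M B X))"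
      "variety q 6 Q = (\<Union>X\<in>conic_plusplus q C. points q 6 (scroll_plane q M B X))"
      using assms(13) unfolding bose_conic_variety_def by blast+
    consider "k = 1" | "k = 3" | "k = 6" using k by blast
    thus ?thesis
    proof cases
      case 1
      have "P \<in> variety q 1 Q \<longleftrightarrow> (\<exists>X\<in>C. P \<in> bose_plane q M X)" unfolding v(1) by blast
      also have "\<dots> \<longleftrightarrow> (\<exists>x. x \<in> vecs_over q 1 \<and> x \<noteq> 0 \<and> quad std_conic x = 0 \<and>
          P \<in> bose_plane q M (vec.span {A *v x}))"
        unfolding A(4) Bex_def matrix_image_quadric_iff by blast
      also have "\<dots> \<longleftrightarrow> (\<exists>x. x \<in> vecs_over q 1 \<and> x \<noteq> 0 \<and> quad std_conic x = 0 \<and>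
          P \<in> points q 1 (scroll x))"
        unfolding bose_plane_def by (metis bose_span_point_over_1[OF refl])
      finally show ?thesis using 1 by simp
    next
      case 2
      have "P \<in> variety q 3 Q \<longleftrightarrow> (\<exists>x. x \<in> vecs_over q 3 \<and> x \<noteq> 0 \<and> quad std_conic x = 0 \<and>
          P \<in> points q 3 (scroll_plane q M B (vec.span {A *v x})))"
        unfolding v(2) plus UN_iff Bex_def matrix_image_quadric_iff by blast
      thus ?thesis using 2 by (simp add: scr)
    next
      case 3
      have "P \<in> variety q 6 Q \<longleftrightarrow> (\<exists>x. x \<in> vecs_over q 6 \<and> x \<noteq> 0 \<and> quad std_conic x = 0 \<and>
          P \<in> points q 6 (scroll_plane q M B (vec.span {A *v x})))"
        unfolding v(3) plusplus UN_iff Bex_def matrix_image_quadric_iff by blast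
      thus ?thesis using 3 by (simp add: scr)
    qed
  qed
  have sS6: "vec.subspace S6" using assms(7) by (auto simp: proj_subspace_def)
  have sE: "vec.subspace (range (diag \<theta>))"
    using diag_plane[OF \<theta>] by (auto simp: proj_subspace_def)
  have main: "variety q k Q \<inter> points q k S6 =
      (points q k (range (diag \<theta>)) \<inter> quadric_points q k N) \<union> points q k (scroll y) \<union> points q k (scroll z)"
    if k: "k \<in> {1, 3, 6}" for k
  proof -
    have mem: "vec.span {v} \<in> points q k V \<longleftrightarrow> v \<in> V"
      if "v \<in> vecs_over q k" "v \<noteq> 0" "vec.subspace V" for v :: "'a ^ 9" and V
      using that vec.span_base[of v "{v}"] vec.span_minimal[of "{v}" V]
      unfolding points_def PG_def by blast
    have quadN: "vec.span {v} \<in> quadric_points q k N \<longleftrightarrow> quad N v = 0"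
      if "v \<in> vecs_over q k" "v \<noteq> 0" for v
    proof
      assume "vec.span {v} \<in> quadric_points q k N"
      thus "quad N v = 0" using vec.span_base[of v "{v}"] by (auto simp: quadric_points_def)
    qed (use that in \<open>auto simp: quadric_points_iff\<close>)
    \<comment> \<open>Every set involved can be tested on a single representative over order
      \<open>q ^ k\<close>, which reduces the equality of pointsets to the statement on
      vectors.\<close>
    have eq: "vec.span {v} \<in> variety q k Q \<inter> points q k S6 \<longleftrightarrow> vec.span {v} \<in>
        (points q k (range (diag \<theta>)) \<inter> quadric_points q k N) \<union> points q k (scroll y) \<union> points q k (scroll z)"
      if v: "v \<in> vecs_over q k" "v \<noteq> 0" for v
    proof -
      have "vec.span {v} \<in> variety q k Q \<inter> points q k S6 \<longleftrightarrow>
          v \<in> S6 \<and> (\<exists>x. x \<in> vecs_over q k \<and> x \<noteq> 0 \<and> quad std_conic x = 0 \<and> v \<in> scroll x)"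
        by (simp add: var[OF k] mem[OF v subspace_scroll] mem[OF v sS6] conj_commute)
      also have "\<dots> \<longleftrightarrow> (\<exists>x. v = diag \<theta> x \<and> quad std_conic x = 0) \<or> v \<in> scroll y \<or> v \<in> scroll z"
        by (rule incidence[OF l(1) \<theta> W yz all rat k v])
      also have "(\<exists>x. v = diag \<theta> x \<and> quad std_conic x = 0) \<longleftrightarrow> v \<in> range (diag \<theta>) \<and> quad N v = 0"
        using N(3) by auto
      finally show ?thesis
        by (simp add: mem[OF v subspace_scroll] mem[OF v sE] quadN[OF v])
    qed
    show ?thesis
    proof (rule set_eqI)
      fix P :: "('a ^ 9) set"
      show "P \<in> variety q k Q \<inter> points q k S6 \<longleftrightarrow> P \<in>
        (points q k (range (diag \<theta>)) \<inter> quadric_points q k N) \<union> points q k (scroll y) \<union> points q k (scroll z)"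
      proof (cases "P \<in> PG q k")
        case True
        then obtain v where "P = vec.span {v}" "v \<in> vecs_over q k" "v \<noteq> 0" by (auto simp: PG_def)
        thus ?thesis using eq by blast
      next
        case False
        thus ?thesis by (auto simp: points_def)
      qed
    qed
  qed
  show ?thesis
    by (intro exI[of _ "range (diag \<theta>)"] exI[of _ N] exI[of _ "scroll y"] exI[of _ "scroll z"]
        conjI ballI diag_plane[OF \<theta>] ES6 ESinf N(1,2) scroll_plane_over_6 yz(1,2) sc_Sinf yz(5,6) pts main
        trans[OF card_spread_planes[OF refl A(2) l(1) \<theta> l(3)] sec])
qed

end
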